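(* Let $A_c\in\mathbb{R}^{n\times n}$, $B_c\in\mathbb{R}^{n\times m}$, $A_d\in\mathbb{R}^{n\times n}$, $B_d\in\mathbb{R}^{n\times m}$, and let $\bm{\Sigma}_c:\ \dot x_c(t)=A_cx_c(t)+B_cu_c(t)$ and $\bm{\Sigma}_d:\ x_d(i+1)=A_dx_d(i)+B_du_d(i)$. For a sampling time $\tau\in\mathbb{R}_{>0}$ and an integer $N\ge 1$, suppose $\bm{\Sigma}_c$ is an $N$-th order interpolator of $\bm{\Sigma}_d$ with respect to the sampling time $\tau$. Then, for any integer $\ell\in\mathbb{Z}_{>0}$, any initial condition $x_0\in\mathbb{R}^n$, any discrete-time input $u_d:\llbracket 0,\ell\rrbracket\to\mathbb{R}^m$, and any $u_c:[0,\ell\tau]\to\mathbb{R}^m$, $$u_c\in\mathcal{U}_c(x_0,u_d)\iff u_c\in\mathbb{I}_N^\tau(u_d)\ \text{ and }\ x_c(\cdot;x_0,u_c)|_{[0,\ell\tau]}\in\mathbb{I}_N^\tau\big(x_d(\cdot;x_0,u_d)|_{\llbracket 0,\ell\rrbracket}\big).$$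
   Context: For integers $k_1\le k_2$, $\llbracket k_1,k_2\rrbracket=\{k\in\mathbb{Z}: k_1\le k\le k_2\}$. $x_c(t;x_0,u_c)$ denotes the solution at time $t$ of $\dot x_c=A_cx_c+B_cu_c$ with $x_c(0)=x_0$ and input $u_c$; $x_d(i;x_0,u_d)$ denotes the solution at step $i$ of $x_d(i+1)=A_dx_d(i)+B_du_d(i)$ with $x_d(0)=x_0$ and input $u_d$. $f|_{I'}$ denotes restriction to $I'$. $\mathbb{P}_N^p$ is the space of $\mathbb{R}^p$-valued polynomials of degree at most $N$. Signal interpolation: for $\ell,p\in\mathbb{Z}_{>0}$ and $s_d:\llbracket 0,\ell\rrbracket\to\mathbb{R}^p$, a function $s_c:[0,\ell\tau]\to\mathbb{R}^p$ is an $N$-th order interpolation of $s_d$ with respect to the sampling time $\tau$ if there exist $P_0,\dots,P_{\ell-1}\in\mathbb{P}_N^p|_{[0,\tau]}$ such that for all $i\in\llbracket 0,\ell-1\rrbracket$: $s_c(i\tau)=s_d(i)$, $s_c((i+1)\tau)=s_d(i+1)$, and $s_c(i\tau+t)=P_i(t)$ for all $t\in[0,\tau]$. The set of all such $s_c$ is denoted $\mathbb{I}_N^\tau(s_d)$. System interpolation: $\bm{\Sigma}_c$ is an $N$-th order interpolator of $\bm{\Sigma}_d$ with respect to the sampling time $\tau$ if for any $\ell\in\mathbb{Z}_{>0}$, any $x_0\in\mathbb{R}^n$ and any $u_d:\llbracket 0,\ell\rrbracket\to\mathbb{R}^m$, there exists $u_c\in\mathbb{I}_N^\tau(u_d)$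 such that $x_c(\cdot;x_0,u_c)|_{[0,\ell\tau]}\in\mathbb{I}_N^\tau\big(x_d(\cdot;x_0,u_d)|_{\llbracket 0,\ell\rrbracket}\big)$. Quadrature nodes: let $\mathfrak{L}_k(t)=\frac{1}{2^k}\sum_{i=0}^{\lfloor k/2\rfloor}(-1)^i\binom{k}{i}\binom{2k-2i}{k}t^{k-2i}$ be the standard Legendre polynomial of degree $k$, and $\mathfrak{L}_k^\tau(t)=\mathfrak{L}_k(2t/\tau-1)$ the shifted one. The nodes $t_{N,0}<t_{N,1}<\dots<t_{N,N}$ are the $N+1$ distinct (real) zeros of $\mathfrak{L}_N^\tau+\mathfrak{L}_{N+1}^\tau$; they satisfy $t_{N,0}=0$ and $t_{N,N}<\tau$. For $i=0,\dots,N$ let $\phi_i(t)=\prod_{j=0,j\ne i}^{N}\frac{t-t_{N,j}}{t_{N,i}-t_{N,j}}$, with derivative $\dot\phi_i$. Define $\Phi=(\phi_1(\tau),\dots,\phi_N(\tau))^\top\in\mathbb{R}^N$; $\psi_j=(\dot\phi_1(t_{N,j}),\dots,\dot\phi_N(t_{N,j}))^\top\in\mathbb{R}^N$ for $j=0,\dots,N$; $\Psi=[\psi_1\ \psi_2\ \cdots\ \psi_N]\in\mathbb{R}^{N\times N}$; $\sigma=[\dot\phi_0(t_{N,1})\ \cdots\ \dot\phi_0(t_{N,N})]\in\mathbb{R}^{1\times N}$. $\otimes$ is the Kronecker product, $N_1\oplus M_1=N_1\otimes I+I\otimes M_1$ is the Kronecker sum of square matrices (so $\Psi^\top\oplus(-A_c)=\Psi^\top\otimes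 I_n-I_N\otimes A_c$), $\operatorname{vec}$ is column-stacking vectorization, and $I$, $0$ are identity and zero matrices of appropriate size. The set $\mathcal{U}_c(x_0,u_d)$: for $0\le i\le\ell-1$, consider matrices $X^i\in\mathbb{R}^{n\times N}$ and $U^i=[U^i_1\ \cdots\ U^i_N]\in\mathbb{R}^{m\times N}$ satisfying $$\text{(a)}\quad \begin{bmatrix}\psi_0^\top\otimes I & 0\\ \Psi^\top\oplus(-A_c) & -I\otimes B_c\\ \Phi^\top\otimes I & 0\\ 0 & \Phi^\top\otimes I\end{bmatrix}\begin{bmatrix}\operatorname{vec}(X^i)\\ \operatorname{vec}(U^i)\end{bmatrix}=\begin{bmatrix} A_c-\dot\phi_0(0)I & B_c & 0\\ -\sigma^\top\otimes I & 0 & 0\\ A_d-\phi_0(\tau)I & B_d & 0\\ 0 & -\phi_0(\tau)I & I\end{bmatrix}\begin{bmatrix}x_d(i;x_0,u_d)\\ u_d(i)\\ u_d(i+1)\end{bmatrix},$$ and functions $u_c^i\in\mathbb{P}_N^m|_{[0,\tau]}$ satisfying $$\text{(b)}\quad u_c^i(t)=\phi_0(t)u_d(i)+\sum_{j=1}^N\phi_j(t)U^i_j\quad\text{for all }t\in[0,\tau].$$ Let $\mathcal{U}_c^i(x_0,u_d)$ be the set of all $u_c^i\in\mathbb{P}_N^m|_{[0,\tau]}$ for which there exist $X^i,U^i$ such that (a) and (b) hold. Then $\mathcal{U}_c(x_0,u_d)$ is the set of all $u_c:[0,\ell\tau]\to\mathbb{R}^m$ such that for every $i\in\llbracket 0,\ell-1\rrbracket$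 there exists $u_c^i\in\mathcal{U}_c^i(x_0,u_d)$ with $u_c(i\tau+t)=u_c^i(t)$ for all $t\in[0,\tau]$. *)

theory Defs
  imports "HOL-Analysis.Analysis" "HOL-Computational_Algebra.Polynomial"
begin

text \<open>
  Conventions. The state and input dimensions \<open>n\<close>, \<open>m\<close> are index types \<open>'n\<close>, \<open>'m\<close>;
  the matrix \<open>A :: real^'c^'r\<close> has rows \<open>'r\<close> and columns \<open>'c\<close>.
  The order \<open>N \<ge> 1\<close> is a natural number for signals and interpolation, and \<open>CARD('N)\<close> for a
  finite linearly ordered index type \<open>'N\<close> wherever matrices with \<open>N\<close> rows or columns occur.
  Functions on \<open>[0, T]\<close> are total functions of which only the values on \<open>{0..T}\<close> are ever
  constrained, and sequences on \<open>0, \<dots>, L\<close> are likewise total on \<open>nat\<close>.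
\<close>

section \<open>Systems and interpolation\<close>

primrec dt_solution ::
  "real^'n^'n \<Rightarrow> real^'m^'n \<Rightarrow> real^'n \<Rightarrow> (nat \<Rightarrow> real^'m) \<Rightarrow> nat \<Rightarrow> real^'n" where
  "dt_solution A B x0 u 0 = x0"
| "dt_solution A B x0 u (Suc i) = A *v dt_solution A B x0 u i + B *v u i"

definition solves_ct ::
  "real^'n^'n \<Rightarrow> real^'m^'n \<Rightarrow> real \<Rightarrow> real^'n \<Rightarrow> (real \<Rightarrow> real^'m) \<Rightarrow> (real \<Rightarrow> real^'n) \<Rightarrow> bool" where
  "solves_ct A B T x0 u x \<longleftrightarrow>
     x 0 = x0 \<and>
     (\<forall>t\<in>{0..T}. (x has_vector_derivative (A *v x t + B *v u t)) (at t within {0..T}))"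

text \<open>
  The value at time \<open>t \<in> [0, T]\<close> of the solution on \<open>[0, T]\<close>. It exists and is unique whenever \<open>u\<close>
  is continuous on \<open>[0, T]\<close>, in particular for the piecewise polynomial interpolations below
  (whose pieces agree at the sampling instants).
\<close>
definition ct_solution ::
  "real^'n^'n \<Rightarrow> real^'m^'n \<Rightarrow> real \<Rightarrow> real^'n \<Rightarrow> (real \<Rightarrow> real^'m) \<Rightarrow> real \<Rightarrow> real^'n" where
  "ct_solution A B T x0 u t = (THE y. \<exists>x. solves_ct A B T x0 u x \<and> y = x t)"

definition poly_on :: "nat \<Rightarrow> real \<Rightarrow> (real \<Rightarrow> real^'p) set" where
  "poly_on N \<tau> =
     {f. \<exists>q :: 'p \<Rightarrow> real poly. (\<forall>k. degree (q k) \<le> N) \<and> (\<forall>t\<in>{0..\<tau>}. f t = (\<chi> k. poly (q k) t))}"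

definition interpolations ::
  "nat \<Rightarrow> real \<Rightarrow> nat \<Rightarrow> (nat \<Rightarrow> real^'p) \<Rightarrow> (real \<Rightarrow> real^'p) set" where
  "interpolations N \<tau> L s\<^sub>d =
     {s\<^sub>c. \<exists>P :: nat \<Rightarrow> real \<Rightarrow> real^'p.
        (\<forall>i<L. P i \<in> poly_on N \<tau>) \<and>
        (\<forall>i<L. s\<^sub>c (real i * \<tau>) = s\<^sub>d i \<and>
               s\<^sub>c (real (i + 1) * \<tau>) = s\<^sub>d (i + 1) \<and>
               (\<forall>t\<in>{0..\<tau>}. s\<^sub>c (real i * \<tau> + t) = P i t))}"

definition is_interpolator ::
  "nat \<Rightarrow> real \<Rightarrow> real^'n^'n \<Rightarrow> real^'m^'n \<Rightarrow> real^'n^'n \<Rightarrow> real^'m^'n \<Rightarrow> bool" where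
  "is_interpolator N \<tau> A\<^sub>c B\<^sub>c A\<^sub>d B\<^sub>d \<longleftrightarrow>
     (\<forall>L::nat. L > 0 \<longrightarrow> (\<forall>x0 u\<^sub>d. \<exists>u\<^sub>c\<in>interpolations N \<tau> L u\<^sub>d.
        ct_solution A\<^sub>c B\<^sub>c (real L * \<tau>) x0 u\<^sub>c
          \<in> interpolations N \<tau> L (dt_solution A\<^sub>d B\<^sub>d x0 u\<^sub>d)))"

section \<open>Quadrature nodes and Lagrange polynomials\<close>

definition legendre :: "nat \<Rightarrow> real \<Rightarrow> real" where
  "legendre k t = 1 / 2 ^ k *
     (\<Sum>i = 0..k div 2. (-1) ^ i * real (k choose i) * real ((2 * k - 2 * i) choose k) * t ^ (k - 2 * i))"

definition shifted_legendre :: "real \<Rightarrow> nat \<Rightarrow> real \<Rightarrow> real" where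
  "shifted_legendre \<tau> k t = legendre k (2 * t / \<tau> - 1)"

text \<open>\<open>node N \<tau> j\<close> for \<open>j = 0, \<dots>, N\<close> lists the \<open>N + 1\<close> distinct real zeros in increasing order.\<close>
definition node :: "nat \<Rightarrow> real \<Rightarrow> nat \<Rightarrow> real" where
  "node N \<tau> j =
     sorted_list_of_set {t. shifted_legendre \<tau> N t + shifted_legendre \<tau> (N + 1) t = 0} ! j"

definition lagr :: "nat \<Rightarrow> real \<Rightarrow> nat \<Rightarrow> real \<Rightarrow> real" where
  "lagr N \<tau> i t = (\<Prod>j\<in>{0..N} - {i}. (t - node N \<tau> j) / (node N \<tau> i - node N \<tau> j))"

section \<open>Kronecker products and block matrices\<close>

text \<open>Row \<open>(i, k)\<close>, column \<open>(j, l)\<close> is entry \<open>(k, l)\<close> of the block \<open>(i, j)\<close>.\<close>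
definition kron :: "real^'b^'a \<Rightarrow> real^'d^'c \<Rightarrow> real^('b \<times> 'd)^('a \<times> 'c)" where
  "kron A M = (\<chi> r s. A $ fst r $ fst s * M $ snd r $ snd s)"

definition kron_sum :: "real^'a^'a \<Rightarrow> real^'b^'b \<Rightarrow> real^('a \<times> 'b)^('a \<times> 'b)" where
  "kron_sum A M = kron A (mat 1) + kron (mat 1) M"

text \<open>Column stacking: the block \<open>j\<close> of \<open>vec_cols X\<close> is the column \<open>j\<close> of \<open>X\<close>.\<close>
definition vec_cols :: "real^'c^'r \<Rightarrow> real^('c \<times> 'r)" where
  "vec_cols X = (\<chi> s. X $ snd s $ fst s)"

text \<open>The index type \<open>1\<close> has one element: these identify \<open>1 \<times> 'r\<close> with \<open>'r\<close>.\<close>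
definition drop_row1 :: "real^'c^(1 \<times> 'r) \<Rightarrow> real^'c^'r" where
  "drop_row1 M = (\<chi> i. M $ (1, i))"

definition drop_col1 :: "real^(1 \<times> 'c)^'r \<Rightarrow> real^'c^'r" where
  "drop_col1 M = (\<chi> i j. M $ i $ (1, j))"

text \<open>\<open>vcat\<close> stacks vectors (\<open>'e = real\<close>) as well as matrices (\<open>'e = real^'c\<close>).\<close>
definition vcat :: "'e^'r \<Rightarrow> 'e^'s \<Rightarrow> 'e^('r + 's)" where
  "vcat A M = (\<chi> i. case i of Inl k \<Rightarrow> A $ k | Inr k \<Rightarrow> M $ k)"

definition hcat :: "real^'c^'r \<Rightarrow> real^'d^'r \<Rightarrow> real^('c + 'd)^'r" where
  "hcat A M = (\<chi> i. vcat (A $ i) (M $ i))"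

section \<open>The input set\<close>

text \<open>The position \<open>1, \<dots>, N\<close> of an index in the linear order of \<open>'N\<close>.\<close>
definition pos :: "'N::{finite,linorder} \<Rightarrow> nat" where
  "pos j = card {i. i \<le> j}"

definition Phi :: "real \<Rightarrow> real^'N::{finite,linorder}" where
  "Phi \<tau> = (\<chi> i. lagr CARD('N) \<tau> (pos i) \<tau>)"

definition psi :: "real \<Rightarrow> nat \<Rightarrow> real^'N::{finite,linorder}" where
  "psi \<tau> j = (\<chi> i. deriv (lagr CARD('N) \<tau> (pos i)) (node CARD('N) \<tau> j))"

definition Psi :: "real \<Rightarrow> real^('N::{finite,linorder})^('N::{finite,linorder})" where
  "Psi \<tau> = (\<chi> i j. psi \<tau> (pos j) $ i)"

definition sigma :: "real \<Rightarrow> real^('N::{finite,linorder})^1" where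
  "sigma \<tau> = (\<chi> i j. deriv (lagr CARD('N) \<tau> 0) (node CARD('N) \<tau> (pos j)))"

definition lhs_matrix ::
  "real \<Rightarrow> real^'n^'n \<Rightarrow> real^'m^'n \<Rightarrow>
   real^(('N::{finite,linorder} \<times> 'n) + ('N \<times> 'm))^('n + ('N \<times> 'n) + 'n + 'm)" where
  "lhs_matrix \<tau> A\<^sub>c B\<^sub>c =
     vcat (hcat (drop_row1 (kron (rowvector (psi \<tau> 0)) (mat 1))) 0)
    (vcat (hcat (kron_sum (transpose (Psi \<tau>)) (- A\<^sub>c)) (- kron (mat 1) B\<^sub>c))
    (vcat (hcat (drop_row1 (kron (rowvector (Phi \<tau>)) (mat 1))) 0)
          (hcat 0 (drop_row1 (kron (rowvector (Phi \<tau>)) (mat 1))))))"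

text \<open>Here \<open>mat c\<close> is the scalar matrix \<open>c I\<close>.\<close>
definition rhs_matrix ::
  "real \<Rightarrow> real^'n^'n \<Rightarrow> real^'m^'n \<Rightarrow> real^'n^'n \<Rightarrow> real^'m^'n \<Rightarrow>
   real^('n + 'm + 'm)^('n + ('N::{finite,linorder} \<times> 'n) + 'n + 'm)" where
  "rhs_matrix \<tau> A\<^sub>c B\<^sub>c A\<^sub>d B\<^sub>d =
     vcat (hcat (A\<^sub>c - mat (deriv (lagr CARD('N) \<tau> 0) 0)) (hcat B\<^sub>c 0))
    (vcat (hcat (- drop_col1 (kron (transpose (sigma \<tau> :: real^('N::{finite,linorder})^1)) (mat 1))) (hcat 0 0))
    (vcat (hcat (A\<^sub>d - mat (lagr CARD('N) \<tau> 0 \<tau>)) (hcat B\<^sub>d 0))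
          (hcat 0 (hcat (- mat (lagr CARD('N) \<tau> 0 \<tau>)) (mat 1)))))"

definition input_pieces ::
  "'N::{finite,linorder} itself \<Rightarrow> real \<Rightarrow> real^'n^'n \<Rightarrow> real^'m^'n \<Rightarrow> real^'n^'n \<Rightarrow> real^'m^'n \<Rightarrow>
   real^'n \<Rightarrow> (nat \<Rightarrow> real^'m) \<Rightarrow> nat \<Rightarrow> (real \<Rightarrow> real^'m) set" where
  "input_pieces _ \<tau> A\<^sub>c B\<^sub>c A\<^sub>d B\<^sub>d x0 u\<^sub>d i =
     {v \<in> poly_on CARD('N) \<tau>. \<exists>(X :: real^('N::{finite,linorder})^'n) (U :: real^('N::{finite,linorder})^'m).
        lhs_matrix \<tau> A\<^sub>c B\<^sub>c *v vcat (vec_cols X) (vec_cols U) =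
        rhs_matrix \<tau> A\<^sub>c B\<^sub>c A\<^sub>d B\<^sub>d *v
          vcat (dt_solution A\<^sub>d B\<^sub>d x0 u\<^sub>d i) (vcat (u\<^sub>d i) (u\<^sub>d (i + 1))) \<and>
        (\<forall>t\<in>{0..\<tau>}. v t = lagr CARD('N) \<tau> 0 t *\<^sub>R u\<^sub>d i +
                          (\<Sum>j\<in>UNIV. lagr CARD('N) \<tau> (pos j) t *\<^sub>R column j U))}"

definition input_set ::
  "'N::{finite,linorder} itself \<Rightarrow> real \<Rightarrow> real^'n^'n \<Rightarrow> real^'m^'n \<Rightarrow> real^'n^'n \<Rightarrow> real^'m^'n \<Rightarrow>
   nat \<Rightarrow> real^'n \<Rightarrow> (nat \<Rightarrow> real^'m) \<Rightarrow> (real \<Rightarrow> real^'m) set" where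
  "input_set N \<tau> A\<^sub>c B\<^sub>c A\<^sub>d B\<^sub>d L x0 u\<^sub>d =
     {u\<^sub>c. \<forall>i<L. \<exists>v\<in>input_pieces N \<tau> A\<^sub>c B\<^sub>c A\<^sub>d B\<^sub>d x0 u\<^sub>d i.
        \<forall>t\<in>{0..\<tau>}. u\<^sub>c (real i * \<tau> + t) = v t}"

end

theory Submission imports Defs begin

text \<open>
  By Rodrigues' formula, the Radau polynomial \<open>L\<^sub>N + L\<^sub>N\<^sub>+\<^sub>1\<close> is a multiple of the \<open>N\<close>-th derivative
  of \<open>(t - 1)\<^sup>N (t + 1)\<^sup>N\<^sup>+\<^sup>1\<close>, so by Rolle's theorem it has \<open>N\<close> distinct zeros in \<open>(-1, 1)\<close> besides the
  simple zero \<open>-1\<close>. Hence there are \<open>N + 1\<close> distinct nodes, the first one being \<open>0\<close>.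

  The rows of the linear system are the collocation conditions \<open>q' = A\<^sub>c q + B\<^sub>c p\<close> at the \<open>N + 1\<close>
  nodes and the end point conditions at \<open>\<tau>\<close>, for the interpolants \<open>q\<close> and \<open>p\<close> of the columns of \<open>X\<close>
  and \<open>U\<close>. Since \<open>q' - A\<^sub>c q - B\<^sub>c p\<close> has degree at most \<open>N\<close>, it vanishes at the nodes iff it vanishes
  identically. So an input piece solves the system iff it steers a polynomial state piece from
  \<open>x\<^sub>d i\<close> to \<open>x\<^sub>d (i + 1)\<close>, and such pieces are glued at the sampling instants. The solution
  \<open>ct_solution\<close> is a definite description, so it also needs existence (a power series on each piece)
  and uniqueness (Gronwall).
\<close>

section \<open>Quadrature nodes\<close>

text \<open>The factor (j + k)! / j! is split into \<open>fact k\<close> and a binomial coefficient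
  because \<open>legendre\<close> contains that binomial coefficient, while \<open>fact k\<close>
  cancels against the normalisation in Rodrigues' formula.\<close>

lemma higher_pderiv_monom_of_real:
  "(pderiv ^^ k) (monom (1::real) (j + k)) = monom (fact k * real ((j + k) choose k)) j"
proof (rule poly_eqI)
  fix n
  have "pochhammer (real (Suc j)) k = fact k * real ((j + k) choose k)"
    using pochhammer_product'[of "1::real" j k]
    by (simp add: binomial_fact add.commute flip: pochhammer_fact)
  then show "coeff ((pderiv ^^ k) (monom (1::real) (j + k))) n
    = coeff (monom (fact k * real ((j + k) choose k)) j) n"
    by (auto simp: coeff_higher_pderiv)
qed

lemma higher_pderiv_monom_less:
  assumes "d < k"
  shows "(pderiv ^^ k) (monom (1::real) d) = 0"
  using assms by (intro poly_eqI) (auto simp: coeff_higher_pderiv)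

text \<open>Expand (t^2 - 1)^k by the binomial theorem and differentiate k times term by
  term.\<close>

lemma legendre_rodrigues:
  "legendre k t = poly ((pderiv ^^ k) ([:-1, 0, 1:] ^ k)) t / (2 ^ k * fact k)"
proof -
  let ?c = "\<lambda>i. (-1) ^ i * real (k choose i)"
  have "[:-1, 0, 1:] ^ k = (monom (1::real) 2 + [:-1:]) ^ k"
    by (simp add: monom_altdef numeral_2_eq_2)
  also have "\<dots> = (\<Sum>i\<le>k. smult (?c i) (monom 1 (2 * k - 2 * i)))"
    unfolding add.commute[of "monom (1::real) 2"]
    by (subst binomial_ring, intro sum.cong)
       (auto simp: monom_power poly_const_pow diff_mult_distrib of_nat_poly mult_ac)
  finally have "(pderiv ^^ k) ([:-1, 0, 1:] ^ k)
      = (\<Sum>i\<le>k. smult (?c i) ((pderiv ^^ k) (monom 1 (2 * k - 2 * i))))"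
    by (simp add: higher_pderiv_sum higher_pderiv_smult)
  \<comment> \<open>For i > k div 2 the monomial has degree 2 k - 2 i < k and is killed by k
    derivatives; this is where the upper limit k div 2 in \<open>legendre\<close> comes
    from.\<close>
  also have "\<dots> = (\<Sum>i = 0..k div 2. smult (?c i) ((pderiv ^^ k) (monom 1 (2 * k - 2 * i))))"
    by (rule sum.mono_neutral_right) (auto intro!: higher_pderiv_monom_less)
  also have "\<dots> = (\<Sum>i = 0..k div 2. smult (?c i)
      (monom (fact k * real ((2 * k - 2 * i) choose k)) (k - 2 * i)))"
  proof (rule sum.cong)
    fix i assume "i \<in> {0..k div 2}"
    \<comment> \<open>Here 2 i <= k, so the truncated subtraction of natural numbers is
      exact.\<close>
    then have "2 * k - 2 * i = (k - 2 * i) + k" by auto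
    then show "smult (?c i) ((pderiv ^^ k) (monom 1 (2 * k - 2 * i))) = smult (?c i)
        (monom (fact k * real ((2 * k - 2 * i) choose k)) (k - 2 * i))"
      using higher_pderiv_monom_of_real[of k "k - 2 * i"] by simp
  qed simp
  finally show ?thesis
    by (simp add: legendre_def poly_sum poly_monom sum_distrib_left sum_divide_distrib)
       (simp add: field_simps)
qed

text \<open>With w = t^2 - 1, spending one of the N + 1 derivatives on w^(N+1) gives 2 (N + 1) t
  w^N. Both Legendre polynomials are then N-th derivatives with the same prefactor, and w^N (1 + t)
  factors as stated.\<close>

lemma legendre_add_Suc:
  "legendre N t + legendre (Suc N) t =
     poly ((pderiv ^^ N) ([:-1, 1:] ^ N * [:1, 1:] ^ Suc N)) t / (2 ^ N * fact N)"
proof -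
  let ?w = "[:-1, 0, 1:] :: real poly"
  have w: "?w = [:-1, 1:] * [:1, 1:]" by simp
  have "(pderiv ^^ Suc N) (?w ^ Suc N)
      = smult (2 * real (Suc N)) ((pderiv ^^ N) (?w ^ N * [:0, 1:]))"
    unfolding funpow_Suc_right o_def pderiv_power_Suc higher_pderiv_smult[symmetric]
    by (rule arg_cong[of _ _ "pderiv ^^ N"]) (simp add: pderiv_pCons mult_ac)
  then have "legendre (Suc N) t
      = poly ((pderiv ^^ N) (?w ^ N * [:0, 1:])) t / (2 ^ N * fact N)"
    by (simp add: legendre_rodrigues del: funpow.simps of_nat_Suc power_Suc)
       (simp add: field_simps)
  moreover have "?w ^ N + ?w ^ N * [:0, 1:] = [:-1, 1:] ^ N * [:1, 1:] ^ Suc N"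
  proof -
    have "?w ^ N + ?w ^ N * [:0, 1:] = ?w ^ N * (1 + [:0, 1:])"
      by (simp only: distrib_left mult_1_right)
    also have "1 + [:0, 1:] = [:1, 1::real:]" by (simp add: one_pCons)
    finally show ?thesis unfolding w power_mult_distrib by (simp only: power_Suc mult_ac)
  qed
  ultimately show ?thesis
    by (simp only: legendre_rodrigues[of N] flip: add_divide_distrib higher_pderiv_add poly_add)
qed

section \<open>Zeros of the Radau polynomial\<close>

text \<open>Induction that adds the largest point: the new gap contributes one more zero of the
  derivative. Recording that all zeros lie strictly between the extreme points allows the end points
  to be added again before the next derivative.\<close>

lemma rolle_roots:
  fixes p :: "real poly"
  assumes "finite S" "card S = Suc m" "\<And>x. x \<in> S \<Longrightarrow> poly p x = 0"
  shows "\<exists>T. finite T \<and> card T = m \<and> T \<subseteq> {Min S<..<Max S} \<and> (\<forall>x\<in>T. poly (pderiv p) x = 0)"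
  using assms
proof (induction S arbitrary: m rule: finite_linorder_max_induct)
  case (insert b S)
  show ?case
  proof (cases "S = {}")
    case True
    then show ?thesis using insert.prems by (intro exI[of _ "{}"]) auto
  next
    case False
    then obtain k where k: "card S = Suc k" "m = Suc k"
      using insert by (cases "card S") auto
    with insert.IH[OF k(1)] insert.prems obtain T where T: "finite T" "card T = k"
      "T \<subseteq> {Min S<..<Max S}" "\<forall>x\<in>T. poly (pderiv p) x = 0" by auto
    have MS: "Max S \<in> S" "Min S \<le> Max S" and b: "Max S < b" using False insert by auto
    from poly_MVT[OF b, of p] obtain x where x: "Max S < x" "x < b" "poly (pderiv p) x = 0"
      using MS b insert.prems by auto
    have "Min (insert b S) = Min S" "Max (insert b S) = b"
      using MS(2) b Min_insert[OF insert(1) False, of b] Max_insert[OF insert(1) False, of b]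
      by linarith+
    moreover have "x \<notin> T" using T x by auto
    ultimately show ?thesis
      using T x k MS by (intro exI[of _ "insert x T"]) force
  qed
qed auto

lemma power_dvd_pderiv:
  fixes q :: "'a::idom poly"
  assumes "q ^ Suc k dvd p"
  shows "q ^ k dvd pderiv p"
proof -
  from assms obtain r where p: "p = q ^ Suc k * r" by (elim dvdE)
  have "pderiv p = q ^ k * (q * pderiv r + smult (of_nat (Suc k)) (pderiv q * r))"
    unfolding p pderiv_mult pderiv_power_Suc
    by (simp add: distrib_left mult_ac del: of_nat_Suc)
  then show ?thesis by simp
qed

text \<open>Each derivative lowers the multiplicity of a factor by at most one.\<close>

lemma power_dvd_higher_pderiv:
  fixes q :: "'a::idom poly"
  assumes "q ^ (k + j) dvd p"
  shows "q ^ k dvd (pderiv ^^ j) p"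
  using assms by (induction j arbitrary: k) (auto intro!: power_dvd_pderiv simp flip: add_Suc)

lemma radau_roots:
  fixes N :: nat and p :: "real poly"
  defines "p \<equiv> [:-1, 1:] ^ N * [:1, 1:] ^ Suc N"
  defines "Z \<equiv> {x. poly ((pderiv ^^ N) p) x = 0}"
  shows "finite Z" "card Z = Suc N" "-1 \<in> Z" "\<And>x. x \<in> Z \<Longrightarrow> -1 \<le> x"
proof -
  have endpoint: "poly ((pderiv ^^ j) p) a = 0" if "[:-a, 1:] ^ k dvd p" "j < k" for a j k
  proof -
    have "[:-a, 1:] ^ 1 dvd [:-a, 1:] ^ (k - j)"
      using that by (intro le_imp_power_dvd) auto
    also have "\<dots> dvd (pderiv ^^ j) p"
      using that by (intro power_dvd_higher_pderiv) auto
    finally show ?thesis by (simp add: poly_eq_0_iff_dvd)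
  qed
  \<comment> \<open>The zero -1 has multiplicity N + 1 and survives N derivatives; the zero 1 has
    multiplicity N and is only guaranteed for fewer than N.\<close>
  have left: "poly ((pderiv ^^ j) p) (-1) = 0" if "j \<le> N" for j
    using endpoint[of "-1" "Suc N" j] that by (simp add: p_def)
  have right: "poly ((pderiv ^^ j) p) 1 = 0" if "j < N" for j
    using endpoint[of 1 N j] that by (simp add: p_def)
  have "\<exists>T. finite T \<and> card T = j \<and> T \<subseteq> {-1<..<1} \<and> (\<forall>x\<in>T. poly ((pderiv ^^ j) p) x = 0)"
    if "j \<le> N" for j
    using that
  proof (induction j)
    case (Suc j)
    then obtain T where T: "finite T" "card T = j" "T \<subseteq> {-1<..<1}"
      "\<forall>x\<in>T. poly ((pderiv ^^ j) p) x = 0" by auto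
    \<comment> \<open>Since j < N, both end points are still zeros of the j-th derivative. Together
      with the j interior zeros they make j + 2 points, and Rolle's theorem returns j + 1 interior
      zeros.\<close>
    let ?S = "insert (-1) (insert 1 T)"
    have "card ?S = Suc (Suc j)" using T by (subst card_insert_disjoint; force)+
    moreover have "Min ?S = -1" "Max ?S = 1"
      by (rule Min_eqI Max_eqI; use T in force)+
    moreover have "poly ((pderiv ^^ j) p) x = 0" if "x \<in> ?S" for x
      using that T left[of j] right[of j] Suc.prems by auto
    ultimately show ?case
      using rolle_roots[of ?S "Suc j" "(pderiv ^^ j) p"] T(1) by auto
  qed (auto intro: exI[of _ "{}"])
  from this[of N] obtain T where T: "finite T" "card T = N" "T \<subseteq> {-1<..<1}"
    "\<forall>x\<in>T. poly ((pderiv ^^ N) p) x = 0" by auto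
  have deg: "degree p = 2 * N + 1"
    unfolding p_def by (subst degree_mult_eq) (auto simp: degree_power_eq simp del: power_Suc)
  then have degN: "degree ((pderiv ^^ N) p) = Suc N" by (simp add: degree_higher_pderiv)
  then have ne: "(pderiv ^^ N) p \<noteq> 0" by auto
  show fin: "finite Z" unfolding Z_def using ne by (rule poly_roots_finite)
  have sub: "insert (-1) T \<subseteq> Z" unfolding Z_def using T left[of N] by auto
  have cardT: "card (insert (-1) T) = Suc N"
    using T by (subst card_insert_disjoint) force+
  \<comment> \<open>The N-th derivative has degree N + 1, so the N interior zeros and -1 exhaust all
    its zeros.\<close>
  have "card Z \<le> Suc N" unfolding Z_def using card_poly_roots_bound[OF ne] degN by simp
  then have eq: "insert (-1) T = Z" using sub fin cardT by (intro card_seteq) auto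
  show "card Z = Suc N" using eq cardT by simp
  show "-1 \<in> Z" using eq by auto
  show "-1 \<le> x" if "x \<in> Z" for x using eq T that by auto
qed

section \<open>Transfer of the zeros from [-1, 1] to the nodes\<close>

context
  fixes N :: nat and \<tau> :: real
  assumes \<tau>: "\<tau> > 0"
begin

text \<open>The affine map \<open>h\<close> sends -1 to 0 and 1 to \<tau>, and carries the zeros
  bijectively. Finiteness and the cardinality are what make \<open>sorted_list_of_set\<close> in
  \<open>node\<close> a list of N + 1 distinct points.\<close>

lemma node_set:
  defines "Z \<equiv> {t. shifted_legendre \<tau> N t + shifted_legendre \<tau> (N + 1) t = 0}"
  shows "finite Z" "card Z = Suc N" "0 \<in> Z" "\<And>x. x \<in> Z \<Longrightarrow> 0 \<le> x"
proof -
  define R where "R = {x. poly ((pderiv ^^ N) ([:-1, 1:] ^ N * [:1, 1:] ^ Suc N)) x = (0::real)}"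
  note roots = radau_roots[where N = N, folded R_def]
  define h where "h s = (s + 1) * \<tau> / 2" for s :: real
  have mem: "t \<in> Z \<longleftrightarrow> 2 * t / \<tau> - 1 \<in> R" for t
    by (simp add: Z_def R_def shifted_legendre_def legendre_add_Suc del: power_Suc)
  have h_inv: "2 * h s / \<tau> - 1 = s" "h (2 * t / \<tau> - 1) = t" for s t
    using \<tau> by (auto simp: h_def field_simps)
  have Z: "Z = h ` R"
  proof (intro set_eqI iffI)
    show "t \<in> h ` R" if "t \<in> Z" for t
      using that mem h_inv(2)[of t] by (intro rev_image_eqI[of "2 * t / \<tau> - 1"]) auto
  qed (auto simp: mem h_inv)
  have inj: "inj h" by (metis h_inv(1) injI)
  show "finite Z" "card Z = Suc N"
    using roots inj by (auto simp: Z card_image inj_on_subset)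
  show "0 \<in> Z" using roots by (simp add: mem)
  show "0 \<le> x" if "x \<in> Z" for x
    using roots(4) that \<tau> by (force simp: Z h_def intro!: mult_nonneg_nonneg)
qed

lemma node_inj: "inj_on (node N \<tau>) {..N}"
  unfolding node_def using node_set
  by (intro inj_on_nth) (auto simp: less_Suc_eq_le)

lemma node_0: "node N \<tau> 0 = 0"
proof -
  let ?Z = "{t. shifted_legendre \<tau> N t + shifted_legendre \<tau> (N + 1) t = 0}"
  have "sorted_list_of_set ?Z = Min ?Z # sorted_list_of_set (?Z - {Min ?Z})"
    using node_set by (intro sorted_list_of_set_nonempty) auto
  moreover have "Min ?Z = 0" using node_set by (intro Min_eqI) auto
  ultimately show ?thesis by (simp add: node_def)
qed

end

section \<open>Lagrange interpolation and collocation\<close>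

text \<open>The function \<open>lagr\<close> as a formal polynomial, which gives access to degree
  bounds and \<open>pderiv\<close>.\<close>

definition lagr_poly :: "nat \<Rightarrow> real \<Rightarrow> nat \<Rightarrow> real poly" where
  "lagr_poly N \<tau> i =
     (\<Prod>j\<in>{0..N} - {i}. smult (1 / (node N \<tau> i - node N \<tau> j)) [:- node N \<tau> j, 1:])"

lemma poly_lagr_poly: "poly (lagr_poly N \<tau> i) = lagr N \<tau> i"
  by (rule ext) (simp add: lagr_poly_def lagr_def poly_prod diff_divide_distrib)

lemma deriv_lagr: "deriv (lagr N \<tau> i) t = poly (pderiv (lagr_poly N \<tau> i)) t"
  by (rule DERIV_imp_deriv) (simp flip: poly_lagr_poly)

lemma degree_lagr_poly:
  assumes "i \<le> N"
  shows "degree (lagr_poly N \<tau> i) \<le> N"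
proof -
  have "degree (lagr_poly N \<tau> i) \<le> (\<Sum>j\<in>{0..N} - {i}. 1)"
    unfolding lagr_poly_def
    by (rule order.trans[OF degree_prod_sum_le])
       (auto intro!: sum_mono order.trans[OF degree_smult_le] simp del: sum_constant smult_pCons split: if_splits)
  then show ?thesis using assms by simp
qed

lemma lagr_node:
  assumes "\<tau> > 0" "i \<le> N" "j \<le> N"
  shows "lagr N \<tau> i (node N \<tau> j) = (if i = j then 1 else 0)"
proof (cases "i = j")
  case True
  have "node N \<tau> j \<noteq> node N \<tau> k" if "k \<in> {0..N} - {j}" for k
    using that assms node_inj[of \<tau> N] by (auto dest: inj_onD)
  then show ?thesis using True by (auto simp: lagr_def intro!: prod.neutral)
next
  case False
  then show ?thesis using assms unfolding lagr_def by (auto intro!: prod_zero bexI[of _ j])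
qed

definition vpoly :: "('p::finite \<Rightarrow> real poly) \<Rightarrow> real \<Rightarrow> real^'p" where
  "vpoly q t = (\<chi> k. poly (q k) t)"

lemma poly_on_iff:
  "f \<in> poly_on N \<tau> \<longleftrightarrow> (\<exists>q. (\<forall>k. degree (q k) \<le> N) \<and> (\<forall>t\<in>{0..\<tau>}. f t = vpoly q t))"
  by (simp add: poly_on_def vpoly_def)

lemma has_vector_derivative_vec_lambda:
  fixes f :: "'p::finite \<Rightarrow> real \<Rightarrow> real"
  assumes "\<And>k. (f k has_real_derivative f' k) (at t within S)"
  shows "((\<lambda>t. \<chi> k. f k t) has_vector_derivative (\<chi> k. f' k)) (at t within S)"
proof -
  have expand: "(\<chi> k. g k) = (\<Sum>k\<in>UNIV. g k *\<^sub>R (axis k 1 :: real^'p))" for g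
    using basis_expansion[of "\<chi> k. g k"] by (simp add: scalar_mult_eq_scaleR)
  show ?thesis unfolding expand
    by (rule has_vector_derivative_sum, rule has_vector_derivative_scaleR[OF assms has_vector_derivative_const, simplified])
qed

lemma has_vector_derivative_vpoly:
  "(vpoly q has_vector_derivative vpoly (pderiv \<circ> q) t) (at t within S)"
  unfolding vpoly_def[abs_def]
  using has_vector_derivative_vec_lambda[of "\<lambda>k. poly (q k)" "\<lambda>k. poly (pderiv (q k)) t" t S]
  by (simp add: DERIV_subset[OF poly_DERIV])

text \<open>Both sides are equivalent to every \<open>r k\<close> being the zero polynomial: on the
  left because N + 1 distinct zeros exceed the degree, on the right because an interval of positive
  length is infinite.\<close>

lemma vpoly_eq_0_nodes_iff:
  assumes "\<tau> > 0" "\<And>k. degree (r k) \<le> N"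
  shows "(\<forall>j\<le>N. vpoly r (node N \<tau> j) = 0) \<longleftrightarrow> (\<forall>t\<in>{0..\<tau>}. vpoly r t = 0)"
proof -
  have "(\<forall>j\<le>N. poly (r k) (node N \<tau> j) = 0) \<longleftrightarrow> r k = 0" for k
  proof
    assume "\<forall>j\<le>N. poly (r k) (node N \<tau> j) = 0"
    moreover have "card (node N \<tau> ` {..N}) = Suc N"
      using node_inj[OF assms(1)] by (simp add: card_image)
    ultimately show "r k = 0"
      using assms(2)[of k] by (intro poly_eqI_degree[of "node N \<tau> ` {..N}"]) auto
  qed auto
  moreover have "(\<forall>t\<in>{0..\<tau>}. poly (r k) t = 0) \<longleftrightarrow> r k = 0" for k
  proof
    assume "\<forall>t\<in>{0..\<tau>}. poly (r k) t = 0"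
    then have "{0..\<tau>} \<subseteq> {t. poly (r k) t = 0}" by auto
    then show "r k = 0"
      using poly_roots_finite[of "r k"] infinite_Icc[OF assms(1)] finite_subset by blast
  qed auto
  ultimately show ?thesis by (simp add: vpoly_def vec_eq_iff) metis
qed

definition interpolant :: "nat \<Rightarrow> real \<Rightarrow> (nat \<Rightarrow> real^'p::finite) \<Rightarrow> 'p \<Rightarrow> real poly" where
  "interpolant N \<tau> c k = (\<Sum>j\<le>N. smult (c j $ k) (lagr_poly N \<tau> j))"

lemma degree_interpolant: "degree (interpolant N \<tau> c k) \<le> N"
  unfolding interpolant_def
  by (intro degree_sum_le order.trans[OF degree_smult_le degree_lagr_poly]) auto

lemma vpoly_interpolant: "vpoly (interpolant N \<tau> c) t = (\<Sum>j\<le>N. lagr N \<tau> j t *\<^sub>R c j)"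
  by (simp add: vpoly_def interpolant_def vec_eq_iff poly_sum poly_lagr_poly mult.commute)

lemma vpoly_pderiv_interpolant:
  "vpoly (pderiv \<circ> interpolant N \<tau> c) t = (\<Sum>j\<le>N. deriv (lagr N \<tau> j) t *\<^sub>R c j)"
  by (simp add: vpoly_def interpolant_def vec_eq_iff poly_sum deriv_lagr pderiv_smult
      higher_pderiv_sum[of 1, simplified]
      mult.commute)

lemma vpoly_interpolant_node:
  assumes "\<tau> > 0" "j \<le> N"
  shows "vpoly (interpolant N \<tau> c) (node N \<tau> j) = c j"
proof -
  have "vpoly (interpolant N \<tau> c) (node N \<tau> j) = (\<Sum>i\<le>N. if i = j then c i else 0)"
    unfolding vpoly_interpolant using assms by (intro sum.cong) (auto simp: lagr_node)
  then show ?thesis using assms by simp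
qed

text \<open>Uniqueness of interpolation: both polynomials have degree at most N and agree at N + 1
  distinct nodes.\<close>

lemma interpolant_vpoly:
  assumes "\<tau> > 0" "\<And>k. degree (q k) \<le> N"
  shows "interpolant N \<tau> (\<lambda>j. vpoly q (node N \<tau> j)) = q"
proof
  fix k
  have "card (node N \<tau> ` {..N}) = Suc N"
    using node_inj[OF assms(1)] by (simp add: card_image)
  then show "interpolant N \<tau> (\<lambda>j. vpoly q (node N \<tau> j)) k = q k"
    using assms(2)[of k] degree_interpolant[of N \<tau> _ k]
      vpoly_interpolant_node[OF assms(1), of _ N "\<lambda>j. vpoly q (node N \<tau> j)"]
    by (intro poly_eqI_degree[of "node N \<tau> ` {..N}"])
      (auto simp: less_Suc_eq_le vpoly_def vec_eq_iff)
qed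

text \<open>Reduces the differential equation on the whole interval to finitely many collocation
  equations, which is the form in which the linear system expresses it.\<close>

lemma solves_ct_vpoly_iff:
  fixes A :: "real^'n^'n" and B :: "real^'m^'n"
  assumes "\<tau> > 0" "\<And>k. degree (q k) \<le> N" "\<And>k. degree (p k) \<le> N"
  shows "solves_ct A B \<tau> x0 (vpoly p) (vpoly q) \<longleftrightarrow> vpoly q 0 = x0 \<and>
    (\<forall>j\<le>N. vpoly (pderiv \<circ> q) (node N \<tau> j) =
       A *v vpoly q (node N \<tau> j) + B *v vpoly p (node N \<tau> j))"
proof -
  \<comment> \<open>The residual of the differential equation, componentwise as a polynomial of
    degree at most N.\<close>
  define r where "r k = pderiv (q k) - (\<Sum>l\<in>UNIV. smult (A $ k $ l) (q l))
    - (\<Sum>l\<in>UNIV. smult (B $ k $ l) (p l))" for k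
  have r: "vpoly r t = 0 \<longleftrightarrow> vpoly (pderiv \<circ> q) t = A *v vpoly q t + B *v vpoly p t" for t
    by (simp add: vpoly_def r_def matrix_vector_mult_def vec_eq_iff poly_sum algebra_simps)
  have "degree (r k) \<le> N" for k
    unfolding r_def
    by (intro degree_diff_le degree_sum_le order.trans[OF degree_smult_le])
       (use assms(2,3) in \<open>auto simp: degree_pderiv intro: order.trans[OF diff_le_self]\<close>)
  note nodes = vpoly_eq_0_nodes_iff[of \<tau> r N, OF assms(1) this]
  \<comment> \<open>As \<tau> > 0, derivatives within the closed interval are unique, also at its
    end points, so the derivative condition becomes an equation between values.\<close>
  have "(vpoly q has_vector_derivative d) (at t within {0..\<tau>}) \<longleftrightarrow> d = vpoly (pderiv \<circ> q) t"
    if "t \<in> {0..\<tau>}" for t d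
    using has_vector_derivative_vpoly[of q t "{0..\<tau>}"] assms(1) that
      vector_derivative_unique_within_closed_interval[of 0 \<tau> t "vpoly q" d]
    by auto
  then show ?thesis
    using nodes unfolding solves_ct_def r by (metis (mono_tags, lifting))
qed

section \<open>Solutions of linear differential equations\<close>

lemma solves_ct_unique:
  fixes A :: "real^'n^'n" and B :: "real^'m^'n"
  assumes "solves_ct A B T x0 u x" "solves_ct A B T x0 u y" "t \<in> {0..T}"
  shows "x t = y t"
proof -
  obtain K where K: "\<And>v. norm (A *v v) \<le> norm v * K"
    using bounded_linear.bounded[OF matrix_vector_mul_bounded_linear[of A]] by blast
  define d where "d s = x s - y s" for s
  have d': "(d has_vector_derivative A *v d s) (at s within {0..T})" if "s \<in> {0..T}" for s
    using has_vector_derivative_diff[of x _ "at s within {0..T}" y] assms(1,2) that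
    unfolding d_def solves_ct_def by (force simp: matrix_vector_mult_diff_distrib)
  \<comment> \<open>A weighted energy of the difference: the exponent 2 K compensates the growth
    bound 2 (d, A d) <= 2 K |d|^2, so \<open>g\<close> is nonincreasing from the value 0.\<close>
  define g where "g s = exp (- 2 * K * s) * (d s \<bullet> d s)" for s
  define g' where "g' s = exp (- 2 * K * s) * (2 * (d s \<bullet> (A *v d s)) - 2 * K * (d s \<bullet> d s))" for s
  have g_deriv: "(g has_real_derivative g' s) (at s within {0..T})" if "s \<in> {0..T}" for s
    unfolding g_def g'_def
    using d'[OF that, unfolded has_vector_derivative_def]
    by (auto intro!: derivative_eq_intros simp: has_field_derivative_def fun_eq_iff
        inner_commute algebra_simps)
  have "g' s \<le> 0" for s
  proof -
    have "d s \<bullet> (A *v d s) \<le> norm (d s) * (norm (d s) * K)"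
      by (rule order.trans[OF norm_cauchy_schwarz]) (intro mult_left_mono K norm_ge_zero)
    then show ?thesis
      unfolding g'_def
      by (intro mult_nonneg_nonpos) (auto simp: dot_square_norm power2_eq_square mult_ac)
  qed
  moreover have "continuous_on {0..t} g"
    using assms(3) g_deriv by (intro continuous_on_subset[OF DERIV_continuous_on[of "{0..T}"]]) auto
  moreover have "(g has_real_derivative g' s) (at s)" if "0 < s" "s < t" for s
    using g_deriv[of s] that assms(3) by (simp add: at_within_Icc_at)
  ultimately have "g t \<le> g 0"
    using assms(3) by (intro DERIV_nonpos_imp_decreasing_open[of 0 t g]) auto
  also have "g 0 = 0" using assms by (simp add: g_def d_def solves_ct_def)
  finally have "d t \<bullet> d t \<le> 0" by (simp add: g_def mult_le_0_iff)
  then have "d t = 0" by (meson inner_gt_zero_iff not_less)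
  then show ?thesis by (simp add: d_def)
qed

lemma ct_solution_eq:
  assumes "solves_ct A B T x0 u x" "t \<in> {0..T}"
  shows "ct_solution A B T x0 u t = x t"
  unfolding ct_solution_def using assms solves_ct_unique by (intro the_equality) blast+

text \<open>The solution is constructed as a power series that converges for all times, so no matrix
  exponential or fixed point argument enters.\<close>

lemma solves_ct_vpoly_exists:
  fixes A :: "real^'n^'n" and B :: "real^'m^'n"
  shows "\<exists>x. solves_ct A B T x0 (vpoly p) x"
proof -
  define b where "b k = (\<Sum>l\<in>UNIV. coeff (p l) k *\<^sub>R column l B)" for k
  have B_vpoly: "(\<lambda>k. t ^ k *\<^sub>R b k) sums (B *v vpoly p t)" for t
  proof -
    have "(\<lambda>k. coeff (p l) k * t ^ k) sums poly (p l) t" for l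
      unfolding poly_altdef
      by (rule sums_finite) (auto simp: not_le coeff_eq_0)
    then have "(\<lambda>k. \<Sum>l\<in>UNIV. (coeff (p l) k * t ^ k) *\<^sub>R column l B) sums
        (\<Sum>l\<in>UNIV. poly (p l) t *\<^sub>R column l B)"
      by (intro sums_sum sums_scaleR_left)
    then show ?thesis
      by (simp add: b_def matrix_mult_sum scalar_mult_eq_scaleR vpoly_def scaleR_sum_right mult.commute)
  qed
  \<comment> \<open>Comparing the coefficients of t^k in x' = A x + B p forces this
    recursion.\<close>
  define c where "c = rec_nat x0 (\<lambda>k ck. (1 / real (Suc k)) *\<^sub>R (A *v ck + b k))"
  have c_0: "c 0 = x0" and c_Suc: "real (Suc k) *\<^sub>R c (Suc k) = A *v c k + b k" for k
    by (simp_all add: c_def del: of_nat_Suc)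
  obtain K where K: "\<And>v. norm (A *v v) \<le> norm v * K" and "K > 0"
    using bounded_linear.pos_bounded[OF matrix_vector_mul_bounded_linear[of A]] by blast
  define M where "M = Max (range (\<lambda>l. degree (p l)))"
  have b_0: "b k = 0" if "k > M" for k
  proof -
    have "degree (p l) \<le> M" for l unfolding M_def by simp
    then have "coeff (p l) k = 0" for l using that by (meson coeff_eq_0 order.strict_trans1)
    then show ?thesis by (simp add: b_def)
  qed
  have summable: "summable (\<lambda>k. t ^ k *\<^sub>R c k)" for t
  \<comment> \<open>Beyond \<open>M\<close> the input coefficients \<open>b k\<close> vanish, so |c
    (k+1)| <= K |c k| / (k + 1); the second summand of the threshold makes K |t| / (k + 1) at most
    1/2.\<close>
  proof (rule summable_ratio_test[of "1/2" "Suc M + nat \<lceil>2 * K * \<bar>t\<bar>\<rceil>"])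
    fix k assume k: "k \<ge> Suc M + nat \<lceil>2 * K * \<bar>t\<bar>\<rceil>"
    have "real (Suc k) * norm (c (Suc k)) = norm (A *v c k)"
      using c_Suc[of k] b_0[of k] k
      by (metis abs_of_nat add.right_neutral norm_scaleR Suc_le_lessD add_leD1)
    also have "\<dots> \<le> norm (c k) * K" by (rule K)
    finally have 1: "real (Suc k) * norm (c (Suc k)) \<le> norm (c k) * K" .
    have 2: "2 * K * \<bar>t\<bar> \<le> real (Suc k)" using k by linarith
    have "real (Suc k) * (\<bar>t\<bar> * norm (c (Suc k))) \<le> \<bar>t\<bar> * (norm (c k) * K)"
      using mult_left_mono[OF 1, of "\<bar>t\<bar>"] by (simp add: mult_ac)
    also have "\<dots> = (2 * K * \<bar>t\<bar>) * norm (c k) / 2" by simp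
    also have "\<dots> \<le> real (Suc k) * norm (c k) / 2"
      using mult_right_mono[OF 2, of "norm (c k)"] by simp
    also have "\<dots> = real (Suc k) * (norm (c k) / 2)" by simp
    finally have "\<bar>t\<bar> * norm (c (Suc k)) \<le> norm (c k) / 2"
      by (subst (asm) mult_le_cancel_left_pos) auto
    from mult_left_mono[OF this, of "\<bar>t\<bar> ^ k"]
    show "norm (t ^ Suc k *\<^sub>R c (Suc k)) \<le> 1 / 2 * norm (t ^ k *\<^sub>R c k)"
      by (simp add: power_abs abs_mult mult_ac)
  qed auto
  define x where "x t = (\<Sum>k. t ^ k *\<^sub>R c k)" for t
  have comp: "(\<lambda>k. c k $ i * t ^ k) sums (x t $ i)" for i t
    using bounded_linear.sums[OF bounded_linear_vec_nth[of i] summable_sums[OF summable[of t]]]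
    by (simp add: x_def mult.commute)
  have "(x has_vector_derivative A *v x t + B *v vpoly p t) (at t within S)" for t S
  proof -
    have series: "(\<lambda>k. t ^ k *\<^sub>R (A *v c k + b k)) sums (A *v x t + B *v vpoly p t)"
      using sums_add[OF bounded_linear.sums[OF matrix_vector_mul_bounded_linear[of A]
            summable_sums[OF summable[of t]]] B_vpoly[of t]]
      by (simp add: x_def matrix_vector_mult_scaleR scaleR_add_right)
    \<comment> \<open>Termwise differentiation is applied to each component, where the series is a
      scalar power series.\<close>
    have "((\<lambda>t. x t $ i) has_real_derivative (A *v x t + B *v vpoly p t) $ i) (at t)" for i
    proof -
      have "(\<lambda>k. diffs (\<lambda>k. c k $ i) k * t ^ k) sums ((A *v x t + B *v vpoly p t) $ i)"
        using bounded_linear.sums[OF bounded_linear_vec_nth[of i] series]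
          c_Suc[THEN arg_cong[of _ _ "\<lambda>v. v $ i"]]
        by (simp add: diffs_def mult.commute del: of_nat_Suc)
      moreover have "((\<lambda>t. \<Sum>k. c k $ i * t ^ k) has_real_derivative
          (\<Sum>k. diffs (\<lambda>k. c k $ i) k * t ^ k)) (at t)"
        using comp by (intro termdiffs_strong_converges_everywhere) (auto simp: sums_iff)
      ultimately show ?thesis
        using comp by (simp add: sums_iff)
    qed
    then show ?thesis
      using has_vector_derivative_vec_lambda[of "\<lambda>i t. x t $ i", OF has_field_derivative_at_within, of "\<lambda>i. (A *v x t + B *v vpoly p t) $ i" t S]
      by (simp del: vector_add_component)
  qed
  moreover have "x 0 = x0"
    using comp[of _ 0] powser_sums_zero[of "\<lambda>k. c k $ _"]
    by (auto simp: vec_eq_iff c_0 dest: sums_unique2)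
  ultimately show ?thesis unfolding solves_ct_def by blast
qed

section \<open>Restricting, translating and gluing solutions\<close>

lemma solves_ct_cong:
  assumes "\<And>t. t \<in> {0..T} \<Longrightarrow> u t = v t" "\<And>t. t \<in> {0..T} \<Longrightarrow> x t = y t" "0 \<le> T"
  shows "solves_ct A B T x0 u x \<longleftrightarrow> solves_ct A B T x0 v y"
proof -
  have "(x has_vector_derivative d) (at t within {0..T}) \<longleftrightarrow>
      (y has_vector_derivative d) (at t within {0..T})" if "t \<in> {0..T}" for t d
    using assms(2) that
    by (intro has_vector_derivative_cong_ev) auto
  then show ?thesis unfolding solves_ct_def using assms by auto
qed

lemma has_vector_derivative_translate:
  fixes x :: "real \<Rightarrow> 'a::real_normed_vector"
  assumes "(x has_vector_derivative d) (at (a + t) within (+) a ` S)"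
  shows "((\<lambda>t. x (a + t)) has_vector_derivative d) (at t within S)"
proof -
  have "((+) a has_vector_derivative 1) (at t within S)"
    by (auto intro!: derivative_eq_intros)
  from vector_diff_chain_within[OF this assms] show ?thesis by (simp add: o_def)
qed

lemma solves_ct_shift:
  assumes "solves_ct A B T x0 u x" "0 \<le> a" "a + \<tau> \<le> T" "0 \<le> \<tau>"
  shows "solves_ct A B \<tau> (x a) (\<lambda>t. u (a + t)) (\<lambda>t. x (a + t))"
  unfolding solves_ct_def
proof (intro conjI ballI)
  fix t assume t: "t \<in> {0..\<tau>}"
  have "(x has_vector_derivative A *v x (a + t) + B *v u (a + t)) (at (a + t) within {0..T})"
    using assms t by (simp add: solves_ct_def)
  then show "((\<lambda>t. x (a + t)) has_vector_derivative A *v x (a + t) + B *v u (a + t))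
      (at t within {0..\<tau>})"
    using assms by (intro has_vector_derivative_translate)
      (auto elim!: has_vector_derivative_within_subset)
qed simp

text \<open>The two closed intervals meet only at \<open>T\<close>. There y 0 = x T, so the values
  and the right-hand sides of both equations agree, and the one-sided derivatives fit
  together.\<close>

lemma solves_ct_append:
  assumes x: "solves_ct A B T x0 u x" and y: "solves_ct A B \<tau> (x T) (\<lambda>t. u (T + t)) y"
    and "0 \<le> T" "0 \<le> \<tau>"
  shows "solves_ct A B (T + \<tau>) x0 u (\<lambda>t. if t \<in> {0..T} then x t else y (t - T))"
  unfolding solves_ct_def
proof (intro conjI ballI)
  let ?z = "\<lambda>t. if t \<in> {0..T} then x t else y (t - T)"
  fix t assume t: "t \<in> {0..T + \<tau>}"
  have "(?z has_vector_derivative (if t \<in> {0..T} then A *v x t + B *v u t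
      else A *v y (t - T) + B *v u t)) (at t within {0..T + \<tau>})"
  proof (rule has_vector_derivative_If_within_closures[where T = "{T..T + \<tau>}"])
    show "t \<in> {0..T} \<union> {T..T + \<tau>}" "{0..T + \<tau>} = {0..T} \<union> {T..T + \<tau>}"
      using t assms by auto
    have int: "closure {0..T} \<inter> closure {T..T + \<tau>} = {T}" using assms by auto
    show "(x has_vector_derivative A *v x t + B *v u t)
        (at t within {0..T} \<union> closure {0..T} \<inter> closure {T..T + \<tau>})"
      if "t \<in> {0..T} \<union> closure {0..T} \<inter> closure {T..T + \<tau>}"
      using that x assms unfolding int by (simp add: solves_ct_def insert_absorb)
    show "((\<lambda>t. y (t - T)) has_vector_derivative A *v y (t - T) + B *v u t)
        (at t within {T..T + \<tau>} \<union> closure {0..T} \<inter> closure {T..T + \<tau>})"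
      if "t \<in> {T..T + \<tau>} \<union> closure {0..T} \<inter> closure {T..T + \<tau>}"
    proof -
      have "(y has_vector_derivative A *v y (t - T) + B *v u t) (at (t - T) within {0..\<tau>})"
        using y that assms unfolding int solves_ct_def
        by (auto dest!: bspec[of _ _ "t - T"])
      then show ?thesis
        using has_vector_derivative_translate[of y _ "- T" t "{T..T + \<tau>}"] assms
        unfolding int by (simp add: insert_absorb)
    qed
    show "x t = y (t - T)" if "t \<in> closure {0..T}" "t \<in> closure {T..T + \<tau>}"
      using that y int by (auto simp: solves_ct_def)
    show "A *v x t + B *v u t = A *v y (t - T) + B *v u t"
      if "t \<in> closure {0..T}" "t \<in> closure {T..T + \<tau>}"
      using that y int by (auto simp: solves_ct_def)
  qed
  moreover have "(if t \<in> {0..T} then A *v x t + B *v u t else A *v y (t - T) + B *v u t)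
      = A *v ?z t + B *v u t" by simp
  ultimately show "(?z has_vector_derivative A *v ?z t + B *v u t) (at t within {0..T + \<tau>})"
    by (simp only:)
qed (use assms in \<open>simp add: solves_ct_def\<close>)

lemma solves_ct_glue:
  assumes "0 < \<tau>"
    and "\<And>i. i < L \<Longrightarrow> solves_ct A B \<tau> (s i) (\<lambda>t. u (real i * \<tau> + t)) (y i)"
    and "\<And>i. i < L \<Longrightarrow> y i \<tau> = s (Suc i)"
  shows "\<exists>x. solves_ct A B (real L * \<tau>) (s 0) u x \<and> x (real L * \<tau>) = s L \<and>
    (\<forall>i<L. \<forall>t\<in>{0..\<tau>}. x (real i * \<tau> + t) = y i t)"
  using assms(2,3)
proof (induction L)
  case 0
  \<comment> \<open>With no pieces the interval is {0}; the filter within a singleton is trivial, so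
    any vector serves as derivative there.\<close>
  have "at (0::real) within {0} = bot" by (simp add: at_within_eq_bot_iff)
  then show ?case
    by (intro exI[of _ "\<lambda>_. s 0"])
       (auto simp: solves_ct_def has_vector_derivative_def has_derivative_within
         intro!: bounded_linear_scaleR_left)
next
  case (Suc L)
  let ?T = "real L * \<tau>"
  obtain x where x: "solves_ct A B ?T (s 0) u x" "x ?T = s L"
    "\<And>i t. i < L \<Longrightarrow> t \<in> {0..\<tau>} \<Longrightarrow> x (real i * \<tau> + t) = y i t"
    using Suc.IH Suc.prems by (metis less_Suc_eq)
  have y: "solves_ct A B \<tau> (x ?T) (\<lambda>t. u (?T + t)) (y L)" using Suc.prems x by simp
  define z where "z t = (if t \<in> {0..?T} then x t else y L (t - ?T))" for t
  have "solves_ct A B (?T + \<tau>) (s 0) u z"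
    unfolding z_def using assms(1) by (intro solves_ct_append x y) auto
  \<comment> \<open>At t = 0 the definition of \<open>z\<close> takes the branch of
    \<open>x\<close>; the initial value of \<open>y L\<close> bridges the two branches.\<close>
  moreover have last: "z (?T + t) = y L t" if "t \<in> {0..\<tau>}" for t
    using that y by (cases "t = 0") (auto simp: z_def solves_ct_def)
  moreover have "z (real i * \<tau> + t) = y i t" if "i < L" "t \<in> {0..\<tau>}" for i t
  proof -
    have "real i * \<tau> + t \<le> real (Suc i) * \<tau>" using that by (simp add: algebra_simps)
    also have "\<dots> \<le> ?T" using that assms(1) by (intro mult_right_mono) auto
    finally show ?thesis using x(3)[OF that] that assms(1) by (simp add: z_def)
  qed
  moreover have "z (?T + \<tau>) = s (Suc L)" using last[of \<tau>] assms(1) Suc.prems(2)[of L] by simp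
  ultimately show ?case
    by (intro exI[of _ z]) (auto simp: less_Suc_eq algebra_simps)
qed

section \<open>The collocation system\<close>

lemma vcat_eq_iff [simp]: "vcat a b = vcat c d \<longleftrightarrow> a = c \<and> b = d"
  by (auto simp: vcat_def vec_eq_iff split: sum.splits)

lemma vcat_mult [simp]: "vcat M M' *v w = vcat (M *v w) (M' *v w)"
  by (auto simp: vcat_def vec_eq_iff matrix_vector_mult_def split: sum.splits)

lemma hcat_mult [simp]: "hcat M M' *v vcat a b = M *v a + M' *v b"
  by (simp add: hcat_def vcat_def vec_eq_iff matrix_vector_mult_def sum.Plus
      flip: UNIV_Plus_UNIV)

lemma uminus_matrix_mult [simp]: "(- M) *v x = - (M *v x)" for M :: "real^'c^'r"
  by (simp add: vec_eq_iff matrix_vector_mult_def sum_negf)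

lemma mat_mult [simp]: "(mat c :: real^'n^'n) *v x = c *\<^sub>R x"
  by (simp add: mat_def vec_eq_iff matrix_vector_mult_def if_distrib[of "\<lambda>a. a * _"] cong: if_cong)

lemma sum_UNIV_prod: "(\<Sum>s\<in>UNIV. f s) = (\<Sum>i\<in>UNIV. \<Sum>j\<in>UNIV. f (i, j))"
  by (simp add: sum.cartesian_product)

text \<open>After \<open>sum_UNIV_prod\<close>, moves a Kronecker delta in the outer index out of
  the inner sum, so that an identity matrix as left Kronecker factor collapses the double
  sum.\<close>

lemma sum_if_const: "(\<Sum>j\<in>S. if P then f j else 0) = (if P then sum f S else 0)"
  by simp

lemma kron_row_mult [simp]:
  "drop_row1 (kron (rowvector p) (mat 1)) *v vec_cols X = (\<Sum>j\<in>UNIV. p $ j *\<^sub>R column j X)"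
  by (simp add: drop_row1_def kron_def rowvector_def mat_def vec_cols_def column_def vec_eq_iff
      matrix_vector_mult_def if_distrib[of "\<lambda>a. a * _"] if_distrib[of "\<lambda>a. _ * a"] mult.assoc
      sum_UNIV_prod sum_if_const cong: if_cong)

text \<open>The identity kron(I, M) vec(X) = vec(M X), with \<open>fst s\<close> the column and
  \<open>snd s\<close> the component.\<close>

lemma kron_mat_mult [simp]:
  "kron (mat 1) M *v vec_cols X = (\<chi> s. (M *v column (fst s) X) $ snd s)"
  by (simp add: kron_def mat_def vec_cols_def column_def vec_eq_iff
      matrix_vector_mult_def if_distrib[of "\<lambda>a. a * _"]
      sum_UNIV_prod sum_if_const cong: if_cong)

text \<open>The identity kron(P^T, I) vec(X) = vec(X P), column by column.\<close>

lemma kron_transpose_mult [simp]: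
  "kron (transpose P) (mat 1) *v vec_cols X
    = (\<chi> s. (\<Sum>j\<in>UNIV. P $ j $ fst s *\<^sub>R column j X) $ snd s)"
  by (simp add: kron_def transpose_def mat_def vec_cols_def column_def vec_eq_iff
      matrix_vector_mult_def if_distrib[of "\<lambda>a. a * _"] if_distrib[of "\<lambda>a. _ * a"] mult.assoc
      sum_UNIV_prod sum_if_const cong: if_cong)

lemma kron_sum_mult [simp]:
  "kron_sum (transpose P) (- A) *v vec_cols X
    = (\<chi> s. ((\<Sum>j\<in>UNIV. P $ j $ fst s *\<^sub>R column j X) - A *v column (fst s) X) $ snd s)"
  by (simp add: kron_sum_def matrix_vector_mult_add_rdistrib vec_eq_iff)

lemma kron_col_mult [simp]:
  "drop_col1 (kron (transpose S) (mat 1)) *v x = (\<chi> s. S $ 1 $ fst s * x $ snd s)"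
  by (simp add: drop_col1_def kron_def transpose_def mat_def vec_eq_iff
      matrix_vector_mult_def if_distrib[of "\<lambda>a. a * _"] if_distrib[of "\<lambda>a. _ * a"] mult.assoc
      cong: if_cong)

text \<open>Splits the system into its four block rows and moves all terms with \<phi>_0 to the
  left, so that each left side is a value or a derivative of an interpolant: the derivative at 0,
  the derivatives at the other nodes, and the two values at \<tau>.\<close>

lemma lhs_eq_rhs_iff:
  fixes A\<^sub>c A\<^sub>d :: "real^'n^'n" and B\<^sub>c B\<^sub>d :: "real^'m^'n"
    and X :: "real^('N::{finite,linorder})^'n" and U :: "real^('N::{finite,linorder})^'m"
  shows "lhs_matrix \<tau> A\<^sub>c B\<^sub>c *v vcat (vec_cols X) (vec_cols U) =
      rhs_matrix \<tau> A\<^sub>c B\<^sub>c A\<^sub>d B\<^sub>d *v vcat x (vcat u u') \<longleftrightarrow>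
    deriv (lagr CARD('N) \<tau> 0) 0 *\<^sub>R x + (\<Sum>j\<in>UNIV. psi \<tau> 0 $ j *\<^sub>R column j X)
      = A\<^sub>c *v x + B\<^sub>c *v u \<and>
    (\<forall>k. deriv (lagr CARD('N) \<tau> 0) (node CARD('N) \<tau> (pos k)) *\<^sub>R x
        + (\<Sum>j\<in>UNIV. psi \<tau> (pos k) $ j *\<^sub>R column j X)
      = A\<^sub>c *v column k X + B\<^sub>c *v column k U) \<and>
    lagr CARD('N) \<tau> 0 \<tau> *\<^sub>R x + (\<Sum>j\<in>UNIV. Phi \<tau> $ j *\<^sub>R column j X) = A\<^sub>d *v x + B\<^sub>d *v u \<and>
    lagr CARD('N) \<tau> 0 \<tau> *\<^sub>R u + (\<Sum>j\<in>UNIV. Phi \<tau> $ j *\<^sub>R column j U) = u'"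
proof -
  have prod_eq: "(\<chi> s. f (fst s) $ snd s) = (\<chi> s. g (fst s) $ snd s) \<longleftrightarrow> (\<forall>k. f k = g k)"
    for f g :: "'N \<Rightarrow> real^'n"
    by (auto simp: vec_eq_iff)
  have block:
    "kron_sum (transpose (Psi \<tau>)) (- A\<^sub>c) *v vec_cols X + (- kron (mat 1) B\<^sub>c) *v vec_cols U
      = (\<chi> s. ((\<Sum>j\<in>UNIV. psi \<tau> (pos (fst s)) $ j *\<^sub>R column j X)
          - A\<^sub>c *v column (fst s) X - B\<^sub>c *v column (fst s) U) $ snd s)"
    by (simp add: vec_eq_iff Psi_def)
  have block':
    "(- drop_col1 (kron (transpose (sigma \<tau> :: real^('N::{finite,linorder})^1)) (mat 1))) *v x
        + (0 *v u + 0 *v u')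
      = (\<chi> s. (- (deriv (lagr CARD('N) \<tau> 0) (node CARD('N) \<tau> (pos (fst s))) *\<^sub>R x)) $ snd s)"
    by (simp add: vec_eq_iff sigma_def)
  show ?thesis
    unfolding lhs_matrix_def rhs_matrix_def vcat_mult hcat_mult vcat_eq_iff block block'
      prod_eq[of "\<lambda>k. (\<Sum>j\<in>UNIV. psi \<tau> (pos k) $ j *\<^sub>R column j X)
          - A\<^sub>c *v column k X - B\<^sub>c *v column k U"
        "\<lambda>k. - (deriv (lagr CARD('N) \<tau> 0) (node CARD('N) \<tau> (pos k)) *\<^sub>R x)"]
    by (simp add: matrix_vector_mult_diff_rdistrib algebra_simps eq_diff_eq)
qed

section \<open>From columns indexed by a type to nodal values numbered from 0\<close>

lemma bij_betw_pos: "bij_betw pos (UNIV :: 'N::{finite,linorder} set) {1..CARD('N)}"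
proof -
  have "strict_mono (pos :: 'N \<Rightarrow> nat)"
    unfolding pos_def
  proof (intro strict_monoI psubset_card_mono)
    show "{i. i \<le> x} \<subset> {i. i \<le> y}" if "x < y" for x y :: 'N
      using that by (intro psubsetI) (auto simp: set_eq_iff intro!: exI[of _ y])
  qed auto
  then have inj: "inj (pos :: 'N \<Rightarrow> nat)" by (rule strict_mono_imp_inj_on)
  have "pos k \<in> {1..CARD('N)}" for k :: 'N
    unfolding pos_def by (auto simp: Suc_le_eq card_gt_0_iff intro!: card_mono)
  then show ?thesis
    using inj by (intro bij_betw_imageI card_seteq) (auto simp: card_image)
qed

text \<open>All N + 1 nodal values in one sequence: index 0 holds the known sample, the indices 1 to
  N hold the columns, which are the unknowns of the system.\<close>

definition nodal :: "'e^'r \<Rightarrow> 'e^('N::{finite,linorder})^'r \<Rightarrow> nat \<Rightarrow> 'e^'r" where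
  "nodal x X j = (if j = 0 then x else column (inv pos j) X)"

lemma pos_neq_0 [simp]: "pos k \<noteq> 0"
  by (metis card_gt_0_iff empty_iff finite mem_Collect_eq not_gr0 order_refl pos_def)

lemma nodal_0 [simp]: "nodal x X 0 = x"
  by (simp add: nodal_def)

lemma nodal_pos [simp]: "nodal x X (pos k) = column k X"
  by (simp add: nodal_def inv_f_f[OF bij_betw_imp_inj_on[OF bij_betw_pos]])

lemma sum_atMost_pos:
  fixes f :: "nat \<Rightarrow> 'a::comm_monoid_add"
  shows "(\<Sum>j\<le>CARD('N::{finite,linorder}). f j) = f 0 + (\<Sum>k\<in>(UNIV::'N set). f (pos k))"
proof -
  have "{..CARD('N)} = insert 0 {1..CARD('N)}" by auto
  then show ?thesis using sum.reindex_bij_betw[OF bij_betw_pos[where 'N = 'N], of f] by simp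
qed

lemma all_atMost_pos:
  "(\<forall>j\<le>CARD('N::{finite,linorder}). P j) \<longleftrightarrow> P 0 \<and> (\<forall>k::'N. P (pos k))"
proof -
  have "{..CARD('N)} = insert 0 (range (pos :: 'N \<Rightarrow> nat))"
    using bij_betw_imp_surj_on[OF bij_betw_pos[where 'N = 'N]] by auto
  then have "(\<forall>j\<in>{..CARD('N)}. P j) \<longleftrightarrow> P 0 \<and> (\<forall>k::'N. P (pos k))" by auto
  then show ?thesis by auto
qed

lemma vpoly_interpolant_nodal:
  fixes U :: "real^('N::{finite,linorder})^'m"
  shows "vpoly (interpolant CARD('N) \<tau> (nodal u U)) t =
    lagr CARD('N) \<tau> 0 t *\<^sub>R u + (\<Sum>j\<in>UNIV. lagr CARD('N) \<tau> (pos j) t *\<^sub>R column j U)"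
  by (simp add: vpoly_interpolant sum_atMost_pos)

text \<open>The first two block rows together are the collocation equations at all N + 1 nodes,
  hence the differential equation; the last two are the conditions at \<tau>.\<close>

lemma lhs_eq_rhs_iff_interpolant:
  fixes A\<^sub>c A\<^sub>d :: "real^'n^'n" and B\<^sub>c B\<^sub>d :: "real^'m^'n"
    and X :: "real^('N::{finite,linorder})^'n" and U :: "real^('N::{finite,linorder})^'m"
    and x :: "real^'n" and u :: "real^'m"
  assumes "\<tau> > 0"
  defines "q \<equiv> interpolant CARD('N) \<tau> (nodal x X)" and "p \<equiv> interpolant CARD('N) \<tau> (nodal u U)"
  shows "lhs_matrix \<tau> A\<^sub>c B\<^sub>c *v vcat (vec_cols X) (vec_cols U) =
      rhs_matrix \<tau> A\<^sub>c B\<^sub>c A\<^sub>d B\<^sub>d *v vcat x (vcat u u') \<longleftrightarrow>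
    solves_ct A\<^sub>c B\<^sub>c \<tau> x (vpoly p) (vpoly q) \<and>
    vpoly q \<tau> = A\<^sub>d *v x + B\<^sub>d *v u \<and> vpoly p \<tau> = u'"
proof -
  note node_0 = node_0[OF assms(1), of "CARD('N)"]
  have val: "vpoly q (node CARD('N) \<tau> j) = nodal x X j" "vpoly p (node CARD('N) \<tau> j) = nodal u U j"
    if "j \<le> CARD('N)" for j
    using that by (simp_all add: q_def p_def vpoly_interpolant_node assms(1))
  \<comment> \<open>Node 0 is the time 0, so the initial condition is built into the
    interpolant.\<close>
  have "vpoly q 0 = x" using val(1)[of 0] by (simp add: node_0)
  moreover have "vpoly (pderiv \<circ> q) (node CARD('N) \<tau> j) =
      deriv (lagr CARD('N) \<tau> 0) (node CARD('N) \<tau> j) *\<^sub>R x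
      + (\<Sum>k\<in>UNIV. psi \<tau> j $ k *\<^sub>R column k X)" for j
    by (simp add: q_def vpoly_pderiv_interpolant sum_atMost_pos psi_def)
  ultimately have "solves_ct A\<^sub>c B\<^sub>c \<tau> x (vpoly p) (vpoly q) \<longleftrightarrow>
      (\<forall>j\<le>CARD('N). deriv (lagr CARD('N) \<tau> 0) (node CARD('N) \<tau> j) *\<^sub>R x
        + (\<Sum>k\<in>UNIV. psi \<tau> j $ k *\<^sub>R column k X) = A\<^sub>c *v nodal x X j + B\<^sub>c *v nodal u U j)"
    using solves_ct_vpoly_iff[of \<tau> q "CARD('N)" p A\<^sub>c B\<^sub>c x] assms(1) val
    by (simp add: q_def p_def degree_interpolant)
  then show ?thesis
    unfolding lhs_eq_rhs_iff all_atMost_pos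
    by (simp add: q_def p_def vpoly_interpolant_nodal Phi_def node_0 conj_ac)
qed

text \<open>Sampling at the nodes recovers the matrix of unknowns from a given polynomial piece;
  this supplies \<open>X\<close> and \<open>U\<close> when the linear system has to be
  solved.\<close>

lemma vpoly_eq_interpolant_nodal:
  assumes "\<tau> > 0" "\<And>k. degree (q k) \<le> CARD('N::{finite,linorder})"
  obtains X :: "real^('N::{finite,linorder})^'p" where "interpolant CARD('N) \<tau> (nodal (vpoly q 0) X) = q"
proof
  let ?X = "(\<chi> k j. vpoly q (node CARD('N) \<tau> (pos j)) $ k) :: real^('N::{finite,linorder})^'p"
  have "nodal (vpoly q 0) ?X j = vpoly q (node CARD('N) \<tau> j)" if "j \<le> CARD('N)" for j
  proof -
    have "\<forall>j\<le>CARD('N). nodal (vpoly q 0) ?X j = vpoly q (node CARD('N) \<tau> j)"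
      unfolding all_atMost_pos by (simp add: node_0 assms(1) column_def vec_eq_iff)
    then show ?thesis using that by blast
  qed
  then have "interpolant CARD('N) \<tau> (nodal (vpoly q 0) ?X)
      = interpolant CARD('N) \<tau> (\<lambda>j. vpoly q (node CARD('N) \<tau> j))"
    by (intro ext) (simp add: interpolant_def)
  then show "interpolant CARD('N) \<tau> (nodal (vpoly q 0) ?X) = q"
    using interpolant_vpoly assms by metis
qed

text \<open>Removes the matrices from the description: \<open>U\<close> and \<open>X\<close> are
  merely the nodal values of the input piece \<open>v\<close> and of a state piece
  \<open>y\<close>.\<close>

lemma input_pieces_iff:
  fixes A\<^sub>c A\<^sub>d :: "real^'n^'n" and B\<^sub>c B\<^sub>d :: "real^'m^'n"
  assumes "\<tau> > 0"
  shows "v \<in> input_pieces TYPE('N::{finite,linorder}) \<tau> A\<^sub>c B\<^sub>c A\<^sub>d B\<^sub>d x0 u\<^sub>d i \<longleftrightarrow>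
    v \<in> poly_on CARD('N) \<tau> \<and> v 0 = u\<^sub>d i \<and> v \<tau> = u\<^sub>d (i + 1) \<and>
    (\<exists>y\<in>poly_on CARD('N) \<tau>. solves_ct A\<^sub>c B\<^sub>c \<tau> (dt_solution A\<^sub>d B\<^sub>d x0 u\<^sub>d i) v y \<and>
       y \<tau> = dt_solution A\<^sub>d B\<^sub>d x0 u\<^sub>d (i + 1))"
    (is "?L \<longleftrightarrow> ?R")
proof
  let ?x = "dt_solution A\<^sub>d B\<^sub>d x0 u\<^sub>d i"
  assume ?L
  then obtain X :: "real^('N::{finite,linorder})^'n" and U :: "real^('N::{finite,linorder})^'m" where
    v_poly: "v \<in> poly_on CARD('N) \<tau>" and
    sys: "lhs_matrix \<tau> A\<^sub>c B\<^sub>c *v vcat (vec_cols X) (vec_cols U) =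
        rhs_matrix \<tau> A\<^sub>c B\<^sub>c A\<^sub>d B\<^sub>d *v vcat ?x (vcat (u\<^sub>d i) (u\<^sub>d (i + 1)))" and
    v: "\<And>t. t \<in> {0..\<tau>} \<Longrightarrow> v t = vpoly (interpolant CARD('N) \<tau> (nodal (u\<^sub>d i) U)) t"
    unfolding input_pieces_def vpoly_interpolant_nodal by blast
  let ?q = "interpolant CARD('N) \<tau> (nodal ?x X)" and ?p = "interpolant CARD('N) \<tau> (nodal (u\<^sub>d i) U)"
  have "vpoly ?p 0 = u\<^sub>d i"
    using vpoly_interpolant_node[OF assms, of 0 "CARD('N)" "nodal (u\<^sub>d i) U"] node_0[OF assms] by simp
  \<comment> \<open>Equation (b) fixes \<open>v\<close> only on [0, \<tau>], so it is exchanged for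
    the interpolant by congruence on that interval.\<close>
  moreover have "solves_ct A\<^sub>c B\<^sub>c \<tau> ?x v (vpoly ?q) \<longleftrightarrow> solves_ct A\<^sub>c B\<^sub>c \<tau> ?x (vpoly ?p) (vpoly ?q)"
    using v assms by (intro solves_ct_cong) auto
  moreover have "vpoly ?q \<in> poly_on CARD('N) \<tau>"
    using degree_interpolant unfolding poly_on_iff by blast
  ultimately show ?R
    using sys v_poly v[of 0] v[of \<tau>] assms
    unfolding lhs_eq_rhs_iff_interpolant[OF assms] by auto
next
  let ?x = "dt_solution A\<^sub>d B\<^sub>d x0 u\<^sub>d i"
  assume R: ?R
  then obtain y where y: "y \<in> poly_on CARD('N) \<tau>" "solves_ct A\<^sub>c B\<^sub>c \<tau> ?x v y"
    "y \<tau> = dt_solution A\<^sub>d B\<^sub>d x0 u\<^sub>d (i + 1)" by blast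
  from R obtain p where p: "\<And>k. degree (p k) \<le> CARD('N)" "\<And>t. t \<in> {0..\<tau>} \<Longrightarrow> v t = vpoly p t"
    unfolding poly_on_iff by blast
  from y(1) obtain q where q: "\<And>k. degree (q k) \<le> CARD('N)" "\<And>t. t \<in> {0..\<tau>} \<Longrightarrow> y t = vpoly q t"
    unfolding poly_on_iff by blast
  obtain U :: "real^('N::{finite,linorder})^'m" where U: "interpolant CARD('N) \<tau> (nodal (vpoly p 0) U) = p"
    using vpoly_eq_interpolant_nodal[OF assms p(1)] .
  obtain X :: "real^('N::{finite,linorder})^'n" where X: "interpolant CARD('N) \<tau> (nodal (vpoly q 0) X) = q"
    using vpoly_eq_interpolant_nodal[OF assms q(1)] .
  have p0: "vpoly p 0 = u\<^sub>d i" using p(2)[of 0] R assms by simp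
  have q0: "vpoly q 0 = ?x" using q(2)[of 0] y(2) assms by (simp add: solves_ct_def)
  have "solves_ct A\<^sub>c B\<^sub>c \<tau> ?x (vpoly p) (vpoly q)"
    using y(2) solves_ct_cong[of \<tau> v "vpoly p" y "vpoly q"] p(2) q(2) assms by simp
  then have "lhs_matrix \<tau> A\<^sub>c B\<^sub>c *v vcat (vec_cols X) (vec_cols U) =
      rhs_matrix \<tau> A\<^sub>c B\<^sub>c A\<^sub>d B\<^sub>d *v vcat ?x (vcat (u\<^sub>d i) (u\<^sub>d (i + 1)))"
    unfolding lhs_eq_rhs_iff_interpolant[OF assms] U[unfolded p0] X[unfolded q0]
    using p(2)[of \<tau>] q(2)[of \<tau>] R y(3) assms by simp
  moreover have "\<forall>t\<in>{0..\<tau>}. v t = lagr CARD('N) \<tau> 0 t *\<^sub>R u\<^sub>d i +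
      (\<Sum>j\<in>UNIV. lagr CARD('N) \<tau> (pos j) t *\<^sub>R column j U)"
    using p(2) U[unfolded p0] vpoly_interpolant_nodal[of \<tau> "u\<^sub>d i" U] by metis
  ultimately show ?L using R unfolding input_pieces_def by blast
qed

section \<open>Assembling the pieces on the whole time interval\<close>

text \<open>The sample conditions are expressed by the values of the pieces at 0 and \<tau>, the
  form in which \<open>input_pieces_iff\<close> provides them.\<close>

lemma interpolationsI:
  assumes "\<tau> \<ge> 0"
    and "\<And>i. i < L \<Longrightarrow> f i \<in> poly_on N \<tau>"
    and "\<And>i. i < L \<Longrightarrow> f i 0 = s\<^sub>d i" "\<And>i. i < L \<Longrightarrow> f i \<tau> = s\<^sub>d (i + 1)"
    and s: "\<And>i t. i < L \<Longrightarrow> t \<in> {0..\<tau>} \<Longrightarrow> s (real i * \<tau> + t) = f i t"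
  shows "s \<in> interpolations N \<tau> L s\<^sub>d"
proof -
  have "s (real i * \<tau>) = s\<^sub>d i" "s (real (i + 1) * \<tau>) = s\<^sub>d (i + 1)" if "i < L" for i
    using s[OF that, of 0] s[OF that, of \<tau>] assms(1,3,4) that by (auto simp: algebra_simps)
  then show ?thesis unfolding interpolations_def using assms(2) s by blast
qed

lemma interpolationsE:
  assumes "\<tau> \<ge> 0" "s \<in> interpolations N \<tau> L s\<^sub>d" "i < L"
  obtains f where "f \<in> poly_on N \<tau>" "f 0 = s\<^sub>d i" "f \<tau> = s\<^sub>d (i + 1)"
    "\<And>t. t \<in> {0..\<tau>} \<Longrightarrow> s (real i * \<tau> + t) = f t"
proof -
  from assms(2) obtain P where P: "\<forall>i<L. P i \<in> poly_on N \<tau>"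
    "\<forall>i<L. s (real i * \<tau>) = s\<^sub>d i \<and> s (real (i + 1) * \<tau>) = s\<^sub>d (i + 1) \<and>
       (\<forall>t\<in>{0..\<tau>}. s (real i * \<tau> + t) = P i t)"
    unfolding interpolations_def by blast
  have eq: "s (real i * \<tau> + t) = P i t" if "t \<in> {0..\<tau>}" for t
    using P(2) assms(3) that by blast
  have "P i 0 = s\<^sub>d i" "P i \<tau> = s\<^sub>d (i + 1)"
    using eq[of 0] eq[of \<tau>] P(2)[rule_format, OF assms(3)] assms(1)
    by (auto simp: algebra_simps)
  then show ?thesis using that[of "P i"] P(1) assms(3) eq by blast
qed

text \<open>Solves on one sampling interval after the other. Existence gives content to
  \<open>ct_solution\<close>, which as a definite description is otherwise unspecified.\<close>

lemma interpolations_solves_ct_exists: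
  fixes A :: "real^'n^'n" and B :: "real^'m^'n"
  assumes "\<tau> > 0" "u \<in> interpolations N \<tau> L u\<^sub>d"
  shows "\<exists>x. solves_ct A B (real L * \<tau>) x0 u x"
proof -
  have piece: "\<exists>y. solves_ct A B \<tau> s (\<lambda>t. u (real i * \<tau> + t)) y" if "i < L" for i s
  proof -
    obtain f where f: "f \<in> poly_on N \<tau>" "\<And>t. t \<in> {0..\<tau>} \<Longrightarrow> u (real i * \<tau> + t) = f t"
      by (rule interpolationsE[OF _ assms(2) \<open>i < L\<close>]) (use assms(1) in auto)
    then obtain p where p: "\<And>t. t \<in> {0..\<tau>} \<Longrightarrow> u (real i * \<tau> + t) = vpoly p t"
      unfolding poly_on_iff by metis
    obtain y where "solves_ct A B \<tau> s (vpoly p) y"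
      using solves_ct_vpoly_exists by blast
    then show ?thesis
      using solves_ct_cong[of \<tau> "\<lambda>t. u (real i * \<tau> + t)" "vpoly p" y y] p assms(1) by auto
  qed
  then obtain y where y: "\<And>i s. i < L \<Longrightarrow> solves_ct A B \<tau> s (\<lambda>t. u (real i * \<tau> + t)) (y i s)"
    by metis
  \<comment> \<open>Each piece starts at the final value of the preceding one, which is the matching
    condition for gluing.\<close>
  define s where "s = rec_nat x0 (\<lambda>i si. y i si \<tau>)"
  have "s 0 = x0" "y i (s i) \<tau> = s (Suc i)" for i by (simp_all add: s_def)
  then show ?thesis
    using solves_ct_glue[of \<tau> L A B s u "\<lambda>i. y i (s i)"] y assms(1) by auto
qed

theorem theorem2:
  fixes A\<^sub>c A\<^sub>d :: "real^'n^'n" and B\<^sub>c B\<^sub>d :: "real^'m^'n"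
    and \<tau> :: real and L :: nat and x0 :: "real^'n"
    and u\<^sub>d :: "nat \<Rightarrow> real^'m" and u\<^sub>c :: "real \<Rightarrow> real^'m"
  assumes "\<tau> > 0"
    and "is_interpolator CARD('N::{finite,linorder}) \<tau> A\<^sub>c B\<^sub>c A\<^sub>d B\<^sub>d"
    and "L > 0"
  shows "u\<^sub>c \<in> input_set TYPE('N) \<tau> A\<^sub>c B\<^sub>c A\<^sub>d B\<^sub>d L x0 u\<^sub>d \<longleftrightarrow>
    u\<^sub>c \<in> interpolations CARD('N) \<tau> L u\<^sub>d \<and>
    ct_solution A\<^sub>c B\<^sub>c (real L * \<tau>) x0 u\<^sub>c
      \<in> interpolations CARD('N) \<tau> L (dt_solution A\<^sub>d B\<^sub>d x0 u\<^sub>d)"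
proof -
  let ?x\<^sub>d = "dt_solution A\<^sub>d B\<^sub>d x0 u\<^sub>d" and ?x\<^sub>c = "ct_solution A\<^sub>c B\<^sub>c (real L * \<tau>) x0 u\<^sub>c"
  have next_sample: "real (i + 1) * \<tau> = real i * \<tau> + \<tau>" for i by (simp add: algebra_simps)
  have range: "0 \<le> real i * \<tau>" "real i * \<tau> + t \<in> {0..real L * \<tau>}" "real i * \<tau> + \<tau> \<le> real L * \<tau>"
    if "i < L" "t \<in> {0..\<tau>}" for i t
  proof -
    have "real i * \<tau> + \<tau> \<le> real L * \<tau>"
      unfolding next_sample[symmetric] using that assms(1) by (intro mult_right_mono) auto
    then show "0 \<le> real i * \<tau>" "real i * \<tau> + t \<in> {0..real L * \<tau>}" "real i * \<tau> + \<tau> \<le> real L * \<tau>"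
      using that assms(1) by auto
  qed
  show ?thesis
  proof
    assume "u\<^sub>c \<in> input_set TYPE('N) \<tau> A\<^sub>c B\<^sub>c A\<^sub>d B\<^sub>d L x0 u\<^sub>d"
    then have "\<exists>v y. v \<in> poly_on CARD('N) \<tau> \<and> v 0 = u\<^sub>d i \<and> v \<tau> = u\<^sub>d (i + 1) \<and>
        (\<forall>t\<in>{0..\<tau>}. u\<^sub>c (real i * \<tau> + t) = v t) \<and>
        y \<in> poly_on CARD('N) \<tau> \<and> solves_ct A\<^sub>c B\<^sub>c \<tau> (?x\<^sub>d i) v y \<and> y \<tau> = ?x\<^sub>d (i + 1)"
      if "i < L" for i
      using that unfolding input_set_def Bex_def input_pieces_iff[OF assms(1)] by blast
    then obtain v y where "v i \<in> poly_on CARD('N) \<tau> \<and> v i 0 = u\<^sub>d i \<and> v i \<tau> = u\<^sub>d (i + 1) \<and>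
        (\<forall>t\<in>{0..\<tau>}. u\<^sub>c (real i * \<tau> + t) = v i t) \<and>
        y i \<in> poly_on CARD('N) \<tau> \<and> solves_ct A\<^sub>c B\<^sub>c \<tau> (?x\<^sub>d i) (v i) (y i) \<and> y i \<tau> = ?x\<^sub>d (i + 1)"
      if "i < L" for i
      by metis
    then have v: "v i \<in> poly_on CARD('N) \<tau>" "v i 0 = u\<^sub>d i" "v i \<tau> = u\<^sub>d (i + 1)"
        "\<And>t. t \<in> {0..\<tau>} \<Longrightarrow> u\<^sub>c (real i * \<tau> + t) = v i t"
      and y: "y i \<in> poly_on CARD('N) \<tau>" "solves_ct A\<^sub>c B\<^sub>c \<tau> (?x\<^sub>d i) (v i) (y i)"
        "y i \<tau> = ?x\<^sub>d (i + 1)" if "i < L" for i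
      using that by blast+
    have "u\<^sub>c \<in> interpolations CARD('N) \<tau> L u\<^sub>d"
      using assms(1) by (intro interpolationsI[where f = v] v) auto
    have "solves_ct A\<^sub>c B\<^sub>c \<tau> (?x\<^sub>d i) (\<lambda>t. u\<^sub>c (real i * \<tau> + t)) (y i)" if "i < L" for i
      using y(2)[OF that] v(4)[OF that] assms(1)
        solves_ct_cong[of \<tau> "\<lambda>t. u\<^sub>c (real i * \<tau> + t)" "v i" "y i" "y i"] by simp
    then obtain x where x: "solves_ct A\<^sub>c B\<^sub>c (real L * \<tau>) x0 u\<^sub>c x"
      "\<And>i t. i < L \<Longrightarrow> t \<in> {0..\<tau>} \<Longrightarrow> x (real i * \<tau> + t) = y i t"
      using solves_ct_glue[of \<tau> L A\<^sub>c B\<^sub>c ?x\<^sub>d u\<^sub>c y] y(3) assms(1) by auto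
    \<comment> \<open>By uniqueness \<open>ct_solution\<close> coincides with the glued solution,
      hence with the polynomial state pieces.\<close>
    have eq: "?x\<^sub>c (real i * \<tau> + t) = y i t" if "i < L" "t \<in> {0..\<tau>}" for i t
      using ct_solution_eq[OF x(1) range(2)[OF that]] x(2)[OF that] by simp
    have "y i 0 = ?x\<^sub>d i" if "i < L" for i
      using y(2)[OF that] by (simp add: solves_ct_def)
    then have "?x\<^sub>c \<in> interpolations CARD('N) \<tau> L ?x\<^sub>d"
      using assms(1) by (intro interpolationsI[where f = y] y eq) auto
    with \<open>u\<^sub>c \<in> interpolations _ _ _ _\<close>
    show "u\<^sub>c \<in> interpolations CARD('N) \<tau> L u\<^sub>d \<and> ?x\<^sub>c \<in> interpolations CARD('N) \<tau> L ?x\<^sub>d" ..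
  next
    assume interp: "u\<^sub>c \<in> interpolations CARD('N) \<tau> L u\<^sub>d \<and> ?x\<^sub>c \<in> interpolations CARD('N) \<tau> L ?x\<^sub>d"
    \<comment> \<open>Interpolation of the samples by \<open>ct_solution\<close> alone yields no
      differential equation; a genuine solution comes from the piecewise polynomial input.\<close>
    then obtain x where x: "solves_ct A\<^sub>c B\<^sub>c (real L * \<tau>) x0 u\<^sub>c x"
      using interpolations_solves_ct_exists[OF assms(1)] by blast
    have "\<exists>v\<in>input_pieces TYPE('N) \<tau> A\<^sub>c B\<^sub>c A\<^sub>d B\<^sub>d x0 u\<^sub>d i.
        \<forall>t\<in>{0..\<tau>}. u\<^sub>c (real i * \<tau> + t) = v t" if i: "i < L" for i
    proof -
      obtain v where v: "v \<in> poly_on CARD('N) \<tau>" "v 0 = u\<^sub>d i" "v \<tau> = u\<^sub>d (i + 1)"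
          "\<And>t. t \<in> {0..\<tau>} \<Longrightarrow> u\<^sub>c (real i * \<tau> + t) = v t"
        by (rule interpolationsE[OF _ conjunct1[OF interp] i]) (use assms(1) in auto)
      obtain y where y: "y \<in> poly_on CARD('N) \<tau>" "y 0 = ?x\<^sub>d i" "y \<tau> = ?x\<^sub>d (i + 1)"
          "\<And>t. t \<in> {0..\<tau>} \<Longrightarrow> ?x\<^sub>c (real i * \<tau> + t) = y t"
        by (rule interpolationsE[OF _ conjunct2[OF interp] i]) (use assms(1) in auto)
      \<comment> \<open>The polynomial piece of \<open>ct_solution\<close> is thus a piece of the
        true solution, which after a shift in time solves the equation on [0, \<tau>].\<close>
      have x_y: "x (real i * \<tau> + t) = y t" if "t \<in> {0..\<tau>}" for t
        using ct_solution_eq[OF x range(2)[OF i that]] y(4)[OF that] by simp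
      have "solves_ct A\<^sub>c B\<^sub>c \<tau> (x (real i * \<tau>)) (\<lambda>t. u\<^sub>c (real i * \<tau> + t))
          (\<lambda>t. x (real i * \<tau> + t))"
        using range[OF i, of 0] assms(1) by (intro solves_ct_shift[OF x]) auto
      then have "solves_ct A\<^sub>c B\<^sub>c \<tau> (x (real i * \<tau>)) v y"
        using solves_ct_cong[of \<tau> "\<lambda>t. u\<^sub>c (real i * \<tau> + t)" v "\<lambda>t. x (real i * \<tau> + t)" y]
          v(4) x_y assms(1) by simp
      then have "v \<in> input_pieces TYPE('N) \<tau> A\<^sub>c B\<^sub>c A\<^sub>d B\<^sub>d x0 u\<^sub>d i"
        using v(1-3) y(1-3) x_y[of 0] assms(1) unfolding input_pieces_iff[OF assms(1)] by auto
      then show ?thesis using v(4) by blast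
    qed
    then show "u\<^sub>c \<in> input_set TYPE('N) \<tau> A\<^sub>c B\<^sub>c A\<^sub>d B\<^sub>d L x0 u\<^sub>d"
      unfolding input_set_def by blast
  qed
qed

end
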